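(* For every $p\in(1,2]$ there is a constant $C_p>0$ depending only on $p$ such that the following holds. Let $f:\mathbb{R}^d\to\mathbb{R}$ satisfy Assumptions A (with $\mu>0$), B ($(H_0,H_1)$-smoothness) and C (stochastic oracle) of the context, and let $F(x_0)\le\Delta_0$. Run RCSAG (see the context) with the balls $Q_s=B\bigl(w_s,\sqrt{2\Delta_s/\mu}\bigr)$, target $\varepsilon\in(0,\Delta_0]$ and confidence $\rho\in(0,1)$. Then, with probability at least $1-\rho$, it returns $w_S$ satisfying $F(w_S)\le\varepsilon$, and its total number $N_{\rm sc}$ of stochastic-gradient calls satisfies, with $q=p/(p-1)$ and $S=\lceil\log_2(\Delta_0/\varepsilon)\rceil$, $$N_{\rm sc}\le C_p\bigl(\log(8/\rho)+\log(S+1)\bigr)\Biggl[\Bigl(1+\sqrt{\tfrac{H_0}{\mu}}\Bigr)S+\sqrt{\tfrac{H_1\Delta_0}{\mu}}+\Bigl(\frac{\sigma_0}{\sqrt{\mu\varepsilon}}\Bigr)^q+\Bigl(\frac{\sigma_1}{\sqrt\mu}\bigl[\sqrt{H_0}\,S^{1/q}+\sqrt{H_1\Delta_0}\bigr]\Bigr)^q+\Bigl(\frac{\sigma_2}{\sqrt\mu}\Bigr)^qS\Biggr].$$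
   Context: Setting. $\|\cdot\|$ is the Euclidean norm on $\mathbb{R}^d$, $B(x,r)$ the closed ball, $f^\star=\min f$, the set of minimizers is nonempty, $x^\star$ is a fixed minimizer, $F(x)=f(x)-f^\star$. Assumption A. $f$ is differentiable and $f(y)\ge f(x)+\langle\nabla f(x),y-x\rangle+\frac{\mu}{2}\|y-x\|^2$ for all $x,y$. Assumption B. $H_0,H_1\ge0$; $r_H:=((2\sqrt3+\sqrt6)\sqrt{H_1})^{-1}$ if $H_1>0$, $r_H:=\infty$ if $H_1=0$; for all $x,y$ with $\|y-x\|\le r_H$, $f(y)\le f(x)+\langle\nabla f(x),y-x\rangle+(H_0+H_1F(x))\|y-x\|^2$. Assumption C. $1<p\le2$, $\sigma_0,\sigma_1,\sigma_2\ge0$. With $\mathcal F_t$ the filtration generated by the samples through (global) iteration $t$ and $\mathbb{E}_t=\mathbb{E}[\cdot\mid\mathcal F_{t-1}]$, every $\mathcal F_{t-1}$-measurable query $x$ admits a fresh sample $g(x,\xi_t)$ with $\mathbb{E}_t[g(x,\xi_t)]=\nabla f(x)$ and $\mathbb{E}_t\|g(x,\xi_t)-\nabla f(x)\|^p\le\sigma_0^p+\sigma_1^p\|\nabla f(x)\|^p+\sigma_2^pF(x)^{p/2}$. One call = one evaluation of $g(x,\xi_t)$ with one fresh sample. RCSAG. Set $w_0=x_0$, $S=\lceil\log_2(\Delta_0/\varepsilon)\rceil$. For $s=0,\dots,S-1$: $\Delta_s=2^{-s}\Delta_0$, $\rho_s=6\rho/[\pi^2(s+1)^2]$, choose $Q_s$,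 $D_s=\operatorname{diam}(Q_s)$ (here $D_s=2\sqrt{2\Delta_s/\mu}$), and let $w_{s+1}$ be the output of RCSAG-Phase$(w_s,\Delta_s,Q_s,D_s,\rho_s)$. Return $w_S$. RCSAG-Phase$(w,\Delta,Q,D,\rho)$. Parameters: $C_\star=19+12\sqrt2$ if $H_1>0$, else $C_\star=2$; $\mathcal H_\Delta=H_0+H_1\Delta$; $G_\Delta=\sqrt{32C_\star\Delta\mathcal H_\Delta}$; $\varsigma_{p,\Delta}^p=\sigma_0^p+\sigma_1^pG_\Delta^p+\sigma_2^p(4\Delta)^{p/2}$; $\Lambda=\max\{2G_\Delta,(64\varsigma_{p,\Delta}^pD/\Delta)^{1/(p-1)}\}$; $R=D\Lambda/\Delta$; $T=\lceil1024(1+R)\log(8/\rho)\rceil$; $a=5D^2/(\Delta T)$; $\operatorname{clip}_\Lambda(v)=v\min\{1,\Lambda/\|v\|\}$ ($\operatorname{clip}_\Lambda(0)=0$, $\operatorname{clip}_0\equiv0$). Set $y_0=z_0=w$, $A_0=D^2/\Delta$, $A_t=A_0+ta$. For $t=1,\dots,T$: $u_t=(A_{t-1}y_{t-1}+az_{t-1})/A_t$; $g_t=g(u_t,\xi_t)$ with one fresh sample; $\widehat g_t=\operatorname{clip}_\Lambda(g_t)$; $z_t=\Pi_Q(z_{t-1}-a\widehat g_t)$ (Euclidean projection); $y_t=(A_{t-1}y_{t-1}+az_t)/A_t$. Return $y_T$. *)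

theory Defs
  imports "HOL-Probability.Probability"
begin

section \<open>The objective\<close>

definition gradient :: "('a::euclidean_space \<Rightarrow> real) \<Rightarrow> 'a \<Rightarrow> 'a" where
  "gradient f x = (THE D. GDERIV f x :> D)"

definition has_minimizer :: "('a::euclidean_space \<Rightarrow> real) \<Rightarrow> bool" where
  "has_minimizer f \<longleftrightarrow> (\<exists>xs. \<forall>x. f xs \<le> f x)"

definition excess :: "('a::euclidean_space \<Rightarrow> real) \<Rightarrow> 'a \<Rightarrow> real" where
  "excess f x = f x - (INF y. f y)"

definition strongly_convex :: "real \<Rightarrow> ('a::euclidean_space \<Rightarrow> real) \<Rightarrow> bool" where
  "strongly_convex \<mu> f \<longleftrightarrow>
     (\<forall>x. f differentiable (at x)) \<and>
     (\<forall>x y. f y \<ge> f x + gradient f x \<bullet> (y - x) + \<mu> / 2 * (norm (y - x))\<^sup>2)"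

definition smoothness_radius :: "real \<Rightarrow> ereal" where
  "smoothness_radius H1 =
     (if H1 > 0 then ereal (inverse ((2 * sqrt 3 + sqrt 6) * sqrt H1)) else \<infinity>)"

definition H0_H1_smooth :: "real \<Rightarrow> real \<Rightarrow> ('a::euclidean_space \<Rightarrow> real) \<Rightarrow> bool" where
  "H0_H1_smooth H0 H1 f \<longleftrightarrow> 0 \<le> H0 \<and> 0 \<le> H1 \<and>
     (\<forall>x y. ereal (norm (y - x)) \<le> smoothness_radius H1 \<longrightarrow>
        f y \<le> f x + gradient f x \<bullet> (y - x) + (H0 + H1 * excess f x) * (norm (y - x))\<^sup>2)"

section \<open>The stochastic oracle\<close>

text \<open>The sigma-algebra generated by the samples \<open>\<xi> 1, \<dots>, \<xi> t\<close>; trivial for \<open>t = 0\<close>.\<close>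

definition sample_filtration ::
    "'w measure \<Rightarrow> 'b measure \<Rightarrow> (nat \<Rightarrow> 'w \<Rightarrow> 'b) \<Rightarrow> nat \<Rightarrow> 'w measure" where
  "sample_filtration M \<Xi> \<xi> t =
     sigma (space M) (\<Union>i\<in>{1..t}. {\<xi> i -` A \<inter> space M | A. A \<in> sets \<Xi>})"

text \<open>
  A query is any random point \<open>x\<close> measurable with respect to \<open>sample_filtration M \<Xi> \<xi> (t - 1)\<close>.
  The vector-valued conditional expectation is taken coordinatewise.  No integrability of
  \<open>g (x \<omega>) (\<xi> t \<omega>)\<close> is demanded, since \<open>x\<close> may be unbounded: the constant \<^const>\<open>real_cond_exp\<close> is the
  difference of the \<open>[0,\<infinity>]\<close>-valued conditional expectations of positive and negative part, both
  of which are almost surely finite by the moment bound.  That bound uses the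
  \<open>[0,\<infinity>]\<close>-valued \<^const>\<open>nn_cond_exp\<close>, so that it does assert finiteness.
\<close>

definition stochastic_oracle ::
    "real \<Rightarrow> real \<Rightarrow> real \<Rightarrow> real \<Rightarrow> ('a::euclidean_space \<Rightarrow> real) \<Rightarrow>
     'w measure \<Rightarrow> 'b measure \<Rightarrow> (nat \<Rightarrow> 'w \<Rightarrow> 'b) \<Rightarrow> ('a \<Rightarrow> 'b \<Rightarrow> 'a) \<Rightarrow> bool" where
  "stochastic_oracle p \<sigma>0 \<sigma>1 \<sigma>2 f M \<Xi> \<xi> g \<longleftrightarrow>
     1 < p \<and> p \<le> 2 \<and> 0 \<le> \<sigma>0 \<and> 0 \<le> \<sigma>1 \<and> 0 \<le> \<sigma>2 \<and>
     prob_space M \<and>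
     (\<forall>t\<ge>1. \<xi> t \<in> measurable M \<Xi>) \<and>
     (\<lambda>(x, z). g x z) \<in> borel_measurable (borel \<Otimes>\<^sub>M \<Xi>) \<and>
     (\<forall>t\<ge>1. \<forall>x \<in> borel_measurable (sample_filtration M \<Xi> \<xi> (t - 1)).
        (AE \<omega> in M. \<forall>b\<in>Basis.
           real_cond_exp M (sample_filtration M \<Xi> \<xi> (t - 1)) (\<lambda>\<omega>'. g (x \<omega>') (\<xi> t \<omega>') \<bullet> b) \<omega>
             = gradient f (x \<omega>) \<bullet> b) \<and>
        (AE \<omega> in M.
           nn_cond_exp M (sample_filtration M \<Xi> \<xi> (t - 1))
             (\<lambda>\<omega>'. ennreal (norm (g (x \<omega>') (\<xi> t \<omega>') - gradient f (x \<omega>')) powr p)) \<omega>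
           \<le> ennreal (\<sigma>0 powr p + \<sigma>1 powr p * norm (gradient f (x \<omega>)) powr p
                + \<sigma>2 powr p * excess f (x \<omega>) powr (p / 2))))"

section \<open>The phase\<close>

text \<open>Since \<open>r / 0 = 0\<close>, this gives \<open>clip \<Lambda> 0 = 0\<close> and \<open>clip 0 v = 0\<close>.\<close>

definition clip :: "real \<Rightarrow> 'a::euclidean_space \<Rightarrow> 'a" where
  "clip \<Lambda> v = min 1 (\<Lambda> / norm v) *\<^sub>R v"

context
  fixes p H0 H1 \<sigma>0 \<sigma>1 \<sigma>2 :: real
begin

definition C_star :: real where
  "C_star = (if H1 > 0 then 19 + 12 * sqrt 2 else 2)"

definition grad_level :: "real \<Rightarrow> real" where
  "grad_level \<Delta> = sqrt (32 * C_star * \<Delta> * (H0 + H1 * \<Delta>))"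

text \<open>This is the \<open>p\<close>-th power of the noise level.\<close>

definition noise_level_pow :: "real \<Rightarrow> real" where
  "noise_level_pow \<Delta> =
     \<sigma>0 powr p + \<sigma>1 powr p * grad_level \<Delta> powr p + \<sigma>2 powr p * (4 * \<Delta>) powr (p / 2)"

definition clip_level :: "real \<Rightarrow> real \<Rightarrow> real" where
  "clip_level \<Delta> D =
     max (2 * grad_level \<Delta>) ((64 * noise_level_pow \<Delta> * D / \<Delta>) powr (1 / (p - 1)))"

definition phase_length :: "real \<Rightarrow> real \<Rightarrow> real \<Rightarrow> nat" where
  "phase_length \<Delta> D \<rho> = nat \<lceil>1024 * (1 + D * clip_level \<Delta> D / \<Delta>) * ln (8 / \<rho>)\<rceil>"

definition step_weight :: "real \<Rightarrow> real \<Rightarrow> real \<Rightarrow> real" where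
  "step_weight \<Delta> D \<rho> = 5 * D\<^sup>2 / (\<Delta> * real (phase_length \<Delta> D \<rho>))"

definition total_weight :: "real \<Rightarrow> real \<Rightarrow> real \<Rightarrow> nat \<Rightarrow> real" where
  "total_weight \<Delta> D \<rho> t = D\<^sup>2 / \<Delta> + real t * step_weight \<Delta> D \<rho>"

text \<open>
  The pair \<open>(y\<^sub>t, z\<^sub>t)\<close>.  The argument \<open>G\<close> is the oracle: \<open>G t u\<close> is the answer to the query \<open>u\<close>
  in iteration \<open>t \<ge> 1\<close> of the phase, and each iteration evaluates it exactly once.
\<close>

primrec phase_state ::
    "(nat \<Rightarrow> 'a \<Rightarrow> 'a) \<Rightarrow> 'a::euclidean_space \<Rightarrow> real \<Rightarrow> 'a set \<Rightarrow> real \<Rightarrow> real \<Rightarrow> nat \<Rightarrow> 'a \<times> 'a"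
where
  "phase_state G w \<Delta> Q D \<rho> 0 = (w, w)"
| "phase_state G w \<Delta> Q D \<rho> (Suc t) =
     (let (y, z) = phase_state G w \<Delta> Q D \<rho> t;
          a = step_weight \<Delta> D \<rho>;
          A = total_weight \<Delta> D \<rho> t;
          A' = total_weight \<Delta> D \<rho> (Suc t);
          u = (A *\<^sub>R y + a *\<^sub>R z) /\<^sub>R A';
          z' = closest_point Q (z - a *\<^sub>R clip (clip_level \<Delta> D) (G (Suc t) u));
          y' = (A *\<^sub>R y + a *\<^sub>R z') /\<^sub>R A'
      in (y', z'))"

definition rcsag_phase ::
    "(nat \<Rightarrow> 'a \<Rightarrow> 'a) \<Rightarrow> 'a::euclidean_space \<Rightarrow> real \<Rightarrow> 'a set \<Rightarrow> real \<Rightarrow> real \<Rightarrow> 'a" where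
  "rcsag_phase G w \<Delta> Q D \<rho> = fst (phase_state G w \<Delta> Q D \<rho> (phase_length \<Delta> D \<rho>))"

end

section \<open>The restarted method\<close>

definition num_phases :: "real \<Rightarrow> real \<Rightarrow> nat" where
  "num_phases \<Delta>0 \<epsilon> = nat \<lceil>log 2 (\<Delta>0 / \<epsilon>)\<rceil>"

definition phase_target :: "real \<Rightarrow> nat \<Rightarrow> real" where
  "phase_target \<Delta>0 s = \<Delta>0 / 2 ^ s"

definition phase_confidence :: "real \<Rightarrow> nat \<Rightarrow> real" where
  "phase_confidence \<rho> s = 6 * \<rho> / (pi\<^sup>2 * (real s + 1)\<^sup>2)"

definition ball_radius :: "real \<Rightarrow> real \<Rightarrow> nat \<Rightarrow> real" where
  "ball_radius \<mu> \<Delta>0 s = sqrt (2 * phase_target \<Delta>0 s / \<mu>)"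

context
  fixes p H0 H1 \<sigma>0 \<sigma>1 \<sigma>2 \<mu> \<Delta>0 \<rho> :: real
begin

text \<open>
  The number of oracle calls made before phase \<open>s\<close> starts.  The phase lengths depend neither on
  the random samples nor on the dimension, because the diameter of the ball of phase \<open>j\<close> is
  \<open>2 * ball_radius \<mu> \<Delta>0 j\<close>, whatever its centre.
\<close>

definition calls_before :: "nat \<Rightarrow> nat" where
  "calls_before s =
     (\<Sum>j<s. phase_length p H0 H1 \<sigma>0 \<sigma>1 \<sigma>2
        (phase_target \<Delta>0 j) (2 * ball_radius \<mu> \<Delta>0 j) (phase_confidence \<rho> j))"

text \<open>
  Here \<open>G n u\<close> is the answer to query \<open>u\<close> in the global iteration \<open>n \<ge> 1\<close>, so iteration \<open>t\<close> of
  phase \<open>s\<close> uses the sample number \<open>calls_before s + t\<close>.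
\<close>

primrec rcsag_iterate :: "(nat \<Rightarrow> 'a \<Rightarrow> 'a) \<Rightarrow> 'a::euclidean_space \<Rightarrow> nat \<Rightarrow> 'a" where
  "rcsag_iterate G x0 0 = x0"
| "rcsag_iterate G x0 (Suc s) =
     rcsag_phase p H0 H1 \<sigma>0 \<sigma>1 \<sigma>2 (\<lambda>t. G (calls_before s + t))
       (rcsag_iterate G x0 s) (phase_target \<Delta>0 s)
       (cball (rcsag_iterate G x0 s) (ball_radius \<mu> \<Delta>0 s)) (2 * ball_radius \<mu> \<Delta>0 s)
       (phase_confidence \<rho> s)"

definition rcsag_output :: "real \<Rightarrow> (nat \<Rightarrow> 'a \<Rightarrow> 'a) \<Rightarrow> 'a::euclidean_space \<Rightarrow> 'a" where
  "rcsag_output \<epsilon> G x0 = rcsag_iterate G x0 (num_phases \<Delta>0 \<epsilon>)"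

definition rcsag_calls :: "real \<Rightarrow> nat" where
  "rcsag_calls \<epsilon> = calls_before (num_phases \<Delta>0 \<epsilon>)"

end

end

theory Submission
  imports Defs
begin

text \<open>
  Fix a phase that starts at \<open>w\<close> with \<open>F w \<le> \<Delta>\<close>, where \<open>F\<close> is the excess over the minimum. Strong
  convexity puts the minimizer \<open>xs\<close> into the ball \<open>Q\<close>, of diameter \<open>D\<close>. The phase runs the method of
  similar triangles, for which the potential \<open>A\<^sub>t F(y\<^sub>t) + |z\<^sub>t - xs|\<^sup>2 / 2\<close> grows in one
  iteration by at most \<open>a \<langle>\<theta>, z - xs\<rangle> + a\<^sup>2 |\<theta>|\<^sup>2\<close>, where \<open>\<theta>\<close> is the gradient at the query point minus
  the clipped sample (\<open>similar_triangles_step\<close>). The potential starts at most at \<open>3/2 D\<^sup>2\<close> and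
  \<open>A\<^sub>T = 6 D\<^sup>2 / \<Delta>\<close>; so if the errors add up to at most \<open>3/2 D\<^sup>2\<close>, the phase ends with \<open>F \<le> \<Delta> / 2\<close>.

  The smoothness assumption is local and its curvature depends on the level of \<open>F\<close>. The number \<open>T\<close>
  of iterations is large enough that each query is at most \<open>\<eta> = 5 D / T\<close> away from the points \<open>y\<close> before
  and after it, and \<open>\<eta>\<close> is small against \<open>\<Delta>\<close> divided by the gradient level. Hence, as long as
  \<open>A\<^sub>t F(y\<^sub>t) \<le> 3 D\<^sup>2\<close>, the queries stay at the level \<open>F \<le> 4 \<Delta>\<close>, the upper model is valid between
  these points, and by a self-bounding inequality (\<open>gradient_self_bound\<close>) the gradient
  is at most half the clipping level \<open>\<Lambda>\<close>.

  Only the \<open>p\<close>-th moment of the noise \<open>\<delta>\<close> is finite. Once the gradient is at most \<open>\<Lambda> / 2\<close>, both the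
  bias and the second moment of the clipped sample are bounded pointwise by multiples of \<open>\<delta>\<^sup>p\<close>,
  and the exponential of the scaled error is at most one plus a mean zero term plus a multiple of
  \<open>\<delta>\<^sup>p\<close> (\<open>exp_clipped_noise_le\<close>). So the exponential of the potential, stopped when
  \<open>A\<^sub>t F(y\<^sub>t) \<le> 3 D\<^sup>2\<close> first fails, is a supermartingale up to a factor
  \<open>1 + ln (8 / \<rho>) / (6 T)\<close> per iteration (\<open>stopped_step\<close>), and Markov's inequality at time \<open>T\<close> bounds the
  failure probability of the phase (\<open>phase_failure\<close>). A union bound over the phases gives the
  probability statement, because the confidences \<open>\<rho>\<^sub>s\<close> sum to at most \<open>\<rho>\<close>.

  For the number of calls, the length of a phase is at most a logarithm times \<open>1 + D \<Lambda> / \<Delta>\<close>, and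
  \<open>D \<Lambda> / \<Delta>\<close> splits into one term for each summand of the bound (\<open>phase_ratio_le\<close>). Along the phases
  each of these terms is constant or is dominated by a geometric sequence: decreasing for the
  terms with \<open>H1 \<Delta>0\<close>, and increasing towards the last phase for the one with \<open>\<sigma>0\<close>, since
  the targets are halved and the last one before the end exceeds \<open>\<epsilon>\<close>.
\<close>

section \<open>Geometry of the objective\<close>

lemma C_star_ge_2: "C_star H1 \<ge> 2"
  by (simp add: C_star_def)

locale objective =
  fixes f :: "'a::euclidean_space \<Rightarrow> real" and \<mu> H0 H1 :: real and xs :: 'a
  assumes minimizer: "f xs \<le> f x"
    and strong: "strongly_convex \<mu> f"
    and smooth: "H0_H1_smooth H0 H1 f"
    and mu_pos: "0 < \<mu>"
begin

abbreviation F where "F \<equiv> excess f"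
abbreviation grad where "grad \<equiv> gradient f"

lemma H_nonneg: "0 \<le> H0" "0 \<le> H1"
  using smooth by (auto simp: H0_H1_smooth_def)

lemma excess_eq: "F x = f x - f xs"
proof -
  have "(INF y. f y) = f xs"
    by (intro cInf_eq_minimum) (auto intro: minimizer)
  then show ?thesis by (simp add: excess_def)
qed

lemma excess_nonneg: "0 \<le> F x"
  using minimizer[of x] by (simp add: excess_eq)

lemma excess_minimizer [simp]: "F xs = 0"
  by (simp add: excess_eq)

lemma excess_lower: "F y \<ge> F x + grad x \<bullet> (y - x) + \<mu> / 2 * (norm (y - x))\<^sup>2"
proof -
  have "f y \<ge> f x + grad x \<bullet> (y - x) + \<mu> / 2 * (norm (y - x))\<^sup>2"
    using strong by (auto simp: strongly_convex_def)
  then show ?thesis by (simp add: excess_eq)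
qed

lemma excess_convex: "F y \<ge> F x + grad x \<bullet> (y - x)"
  using excess_lower[of x y] mu_pos by (smt (verit) mult_nonneg_nonneg divide_nonneg_pos zero_le_power2)

text \<open>
  The radius condition in polynomial form: \<open>(2 * sqrt 3 + sqrt 6)\<^sup>2 = 18 + 12 * sqrt 2\<close>, and the case
  distinction on \<open>H1\<close> disappears.
\<close>

lemma excess_upper:
  assumes "(18 + 12 * sqrt 2) * H1 * (norm (y - x))\<^sup>2 \<le> 1"
  shows "F y \<le> F x + grad x \<bullet> (y - x) + (H0 + H1 * F x) * (norm (y - x))\<^sup>2"
proof -
  have k: "(2 * sqrt 3 + sqrt 6)\<^sup>2 = 18 + 12 * sqrt 2"
  proof -
    have "sqrt 3 * sqrt 6 = sqrt (9 * 2)" by (simp flip: real_sqrt_mult)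
    also have "\<dots> = 3 * sqrt 2" by (simp only: real_sqrt_mult) (simp add: real_sqrt_eq_iff)
    finally show ?thesis by (simp add: power2_eq_square algebra_simps)
  qed
  have "ereal (norm (y - x)) \<le> smoothness_radius H1"
  proof (cases "H1 > 0")
    case True
    define c where "c = (2 * sqrt 3 + sqrt 6) * sqrt H1"
    have c: "c > 0" using True by (simp add: c_def add_pos_pos)
    have "(c * norm (y - x))\<^sup>2 = (18 + 12 * sqrt 2) * H1 * (norm (y - x))\<^sup>2"
      using True by (simp add: c_def power_mult_distrib k)
    with assms have "(c * norm (y - x))\<^sup>2 \<le> 1\<^sup>2" by simp
    then have "c * norm (y - x) \<le> 1" by (rule power2_le_imp_le) simp
    then have "norm (y - x) \<le> inverse c" using c by (simp add: field_simps)
    then show ?thesis using True by (simp add: smoothness_radius_def c_def)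
  qed (simp add: smoothness_radius_def)
  then have "f y \<le> f x + grad x \<bullet> (y - x) + (H0 + H1 * F x) * (norm (y - x))\<^sup>2"
    using smooth by (auto simp: H0_H1_smooth_def)
  then show ?thesis by (simp add: excess_eq)
qed

lemma curvature_nonneg: "0 \<le> H0 + H1 * F x"
  using H_nonneg excess_nonneg[of x] by simp

text \<open>
  A step of length \<open>s\<close> against the gradient cannot push \<open>F\<close> below \<open>0\<close>.
\<close>

lemma gradient_step:
  assumes "0 \<le> s" "(18 + 12 * sqrt 2) * H1 * s\<^sup>2 \<le> 1"
  shows "s * norm (grad x) \<le> F x + (H0 + H1 * F x) * s\<^sup>2"
proof (cases "grad x = 0")
  case True
  then show ?thesis using excess_nonneg[of x] curvature_nonneg[of x] by simp
next
  case False
  define y where "y = x - (s / norm (grad x)) *\<^sub>R grad x"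
  have n: "norm (y - x) = s" using False assms by (simp add: y_def)
  have "grad x \<bullet> (y - x) = - (s / norm (grad x)) * (grad x \<bullet> grad x)"
    by (simp add: y_def)
  also have "\<dots> = - s * norm (grad x)"
    using False by (simp add: dot_square_norm power2_eq_square)
  finally show ?thesis
    using excess_upper[of y x] excess_nonneg[of y] assms n by simp
qed

text \<open>
  The step \<open>norm (grad x) / (2 * h)\<close> with \<open>h = H0 + H1 * F x\<close> is optimal; if it is longer
  than the radius of validity of the upper model, the step equal to that radius is used.
\<close>

lemma gradient_self_bound:
  "(norm (grad x))\<^sup>2 \<le> 2 * C_star H1 * F x * (H0 + H1 * F x)"
proof -
  define h where "h = H0 + H1 * F x"
  define n where "n = norm (grad x)"
  define K where "K = 18 + 12 * sqrt 2"
  have h: "0 \<le> h" using curvature_nonneg by (simp add: h_def)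
  have F: "0 \<le> F x" by (rule excess_nonneg)
  have n: "0 \<le> n" by (simp add: n_def)
  have K: "18 \<le> K" by (simp add: K_def)
  have step: "s * n \<le> F x + h * s\<^sup>2" if "0 \<le> s" "K * H1 * s\<^sup>2 \<le> 1" for s
    using gradient_step[of s x] that by (simp add: h_def n_def K_def)
  have easy: ?thesis if "n\<^sup>2 \<le> 4 * F x * h"
  proof -
    have "4 * (F x * h) \<le> 2 * C_star H1 * (F x * h)"
      using C_star_ge_2[of H1] F h by (intro mult_right_mono) auto
    then show ?thesis using that by (simp add: h_def n_def algebra_simps)
  qed
  show ?thesis
  proof (cases "h > 0 \<and> K * H1 * (n / (2 * h))\<^sup>2 \<le> 1")
    case True
    then have "n / (2 * h) * n \<le> F x + h * (n / (2 * h))\<^sup>2"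
      using n by (intro step) auto
    then have "n\<^sup>2 \<le> 4 * F x * h" using True
      by (simp add: field_simps power2_eq_square)
    then show ?thesis by (rule easy)
  next
    case False
    show ?thesis
    proof (cases "n = 0")
      case True
      then show ?thesis using F h by (intro easy) simp
    next
      case n0: False
      with n have n_pos: "n > 0" by simp
      have H1: "H1 > 0"
      proof (rule ccontr)
        assume "\<not> H1 > 0"
        with H_nonneg have H1: "H1 = 0" by simp
        with False h have "h = 0" by auto
        then have "s * n \<le> F x" if "0 \<le> s" for s using step[of s] that H1 by simp
        from this[of "(F x + 1) / n"] n_pos F show False by simp
      qed
      define r where "r = 1 / sqrt (K * H1)"
      have r: "r > 0" "K * H1 * r\<^sup>2 = 1"
        using H1 K by (auto simp: r_def power_divide)
      \<comment> \<open>the unconstrained step \<open>n / (2 * h)\<close> is longer than the radius \<open>r\<close>\<close>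
      have hr: "2 * h * r \<le> n"
      proof (cases "h > 0")
        case True
        with False have "1 < K * H1 * (n / (2 * h))\<^sup>2" by auto
        then have "K * H1 * r\<^sup>2 < K * H1 * (n / (2 * h))\<^sup>2" using r by simp
        then have "r\<^sup>2 < (n / (2 * h))\<^sup>2" using K H1 by (simp add: mult_less_cancel_left_pos)
        then have "r < n / (2 * h)" by (rule power2_less_imp_less) (use n True in auto)
        then show ?thesis using True by (simp add: field_simps)
      qed (use h n in auto)
      have s: "r * n \<le> F x + h * r\<^sup>2" using r by (intro step) auto
      have hF: "h * r\<^sup>2 \<le> F x"
      proof -
        have "2 * h * r * r \<le> n * r" using hr r by (intro mult_right_mono) auto
        with s show ?thesis by (simp add: power2_eq_square mult_ac)
      qed
      have "(r * n)\<^sup>2 \<le> (F x + h * r\<^sup>2)\<^sup>2" using s r n by (intro power_mono) auto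
      also have "\<dots> = F x * F x + (2 * F x + h * r\<^sup>2) * (h * r\<^sup>2)"
        by (simp add: power2_eq_square algebra_simps)
      also have "\<dots> \<le> F x * F x + (2 * F x + F x) * (h * r\<^sup>2)"
        using hF h by (intro add_left_mono mult_right_mono) auto
      also have "F x * F x = K * (H1 * F x) * F x * r\<^sup>2"
        using r by (simp add: mult_ac)
      also have "\<dots> \<le> K * h * F x * r\<^sup>2"
        using K F H_nonneg by (intro mult_right_mono mult_left_mono) (auto simp: h_def)
      finally have "(n\<^sup>2) * r\<^sup>2 \<le> ((K + 3) * F x * h) * r\<^sup>2"
        by (simp add: algebra_simps power_mult_distrib)
      then have "n\<^sup>2 \<le> (K + 3) * (F x * h)" using r by simp
      also have "\<dots> \<le> 2 * C_star H1 * (F x * h)"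
        using F h H1 by (intro mult_right_mono) (auto simp: K_def C_star_def)
      finally show ?thesis by (simp add: h_def n_def mult_ac)
    qed
  qed
qed

text \<open>
  Near the minimizer \<open>F\<close> lies between quadratics with coefficients \<open>\<mu> / 2\<close> and \<open>H0\<close>. Positivity of
  \<open>H0\<close> rules out a degenerate clipping level \<open>0\<close>.
\<close>

lemma H0_pos: "0 < H0"
proof -
  obtain b :: 'a where b: "b \<in> Basis" using nonempty_Basis by blast
  define K where "K = (18 + 12 * sqrt 2) * (1 + H1)"
  define s where "s = inverse (sqrt K)"
  define y where "y = xs + s *\<^sub>R b"
  have K: "K > 0"
    unfolding K_def using H_nonneg by (intro mult_pos_pos add_pos_nonneg) auto
  have s: "s > 0" "K * s\<^sup>2 = 1"
    using K by (auto simp: s_def power_inverse)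
  have n: "norm (y - xs) = s" using b s by (simp add: y_def)
  have "(18 + 12 * sqrt 2) * H1 * s\<^sup>2 \<le> K * s\<^sup>2"
    unfolding K_def by (intro mult_right_mono mult_left_mono) auto
  then have "F y \<le> F xs + grad xs \<bullet> (y - xs) + (H0 + H1 * F xs) * (norm (y - xs))\<^sup>2"
    using s n by (intro excess_upper) simp
  with excess_lower[of xs y] have "\<mu> / 2 * s\<^sup>2 \<le> H0 * s\<^sup>2" using n by simp
  then have "\<mu> / 2 \<le> H0" using s by simp
  then show ?thesis using mu_pos by simp
qed

lemma grad_minimizer [simp]: "grad xs = 0"
  using gradient_self_bound[of xs] by simp

lemma norm_le_excess: "\<mu> / 2 * (norm (x - xs))\<^sup>2 \<le> F x"
  using excess_lower[of xs x] by simp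

lemma norm_grad_le_grad_level:
  assumes "F x \<le> 4 * \<Delta>"
  shows "norm (grad x) \<le> grad_level H0 H1 \<Delta>"
proof -
  have F: "0 \<le> F x" by (rule excess_nonneg)
  have "(norm (grad x))\<^sup>2 \<le> 2 * C_star H1 * F x * (H0 + H1 * F x)"
    by (rule gradient_self_bound)
  also have "\<dots> \<le> 2 * C_star H1 * (4 * \<Delta>) * (4 * (H0 + H1 * \<Delta>))"
  proof -
    have "H1 * F x \<le> H1 * (4 * \<Delta>)" using assms H_nonneg by (intro mult_left_mono)
    then have "H0 + H1 * F x \<le> 4 * (H0 + H1 * \<Delta>)" using H_nonneg by (simp add: algebra_simps)
    then show ?thesis using assms F C_star_ge_2[of H1] H_nonneg
      by (intro mult_mono) auto
  qed
  also have "\<dots> = 32 * C_star H1 * \<Delta> * (H0 + H1 * \<Delta>)" by (simp add: algebra_simps)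
  finally show ?thesis unfolding grad_level_def by (rule real_le_rsqrt)
qed

lemma grad_level_sq:
  assumes "0 < \<Delta>"
  shows "(grad_level H0 H1 \<Delta>)\<^sup>2 = 32 * C_star H1 * \<Delta> * (H0 + H1 * \<Delta>)"
  using assms H_nonneg C_star_ge_2[of H1] by (simp add: grad_level_def)

lemma grad_level_pos: "0 < \<Delta> \<Longrightarrow> 0 < grad_level H0 H1 \<Delta>"
  using H_nonneg H0_pos C_star_ge_2[of H1] by (simp add: grad_level_def add_pos_nonneg)

text \<open>
  The first bound controls the curvature at the level of \<open>\<Delta>\<close>, the second one the radius within which
  the upper model is valid.
\<close>

lemma grad_level_sq_ge:
  assumes "0 < \<Delta>"
  shows "64 * \<Delta> * (H0 + H1 * \<Delta>) \<le> (grad_level H0 H1 \<Delta>)\<^sup>2"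
    and "32 * (18 + 12 * sqrt 2) * H1 * \<Delta>\<^sup>2 \<le> (grad_level H0 H1 \<Delta>)\<^sup>2"
proof -
  have nn: "0 \<le> \<Delta> * (H0 + H1 * \<Delta>)" using assms H_nonneg by simp
  show "64 * \<Delta> * (H0 + H1 * \<Delta>) \<le> (grad_level H0 H1 \<Delta>)\<^sup>2"
  proof -
    have "32 * (2 * (\<Delta> * (H0 + H1 * \<Delta>))) \<le> 32 * (C_star H1 * (\<Delta> * (H0 + H1 * \<Delta>)))"
      using nn C_star_ge_2[of H1] by (intro mult_left_mono mult_right_mono) auto
    then show ?thesis using assms by (simp only: grad_level_sq mult.assoc)
  qed
  show "32 * (18 + 12 * sqrt 2) * H1 * \<Delta>\<^sup>2 \<le> (grad_level H0 H1 \<Delta>)\<^sup>2"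
  proof (cases "H1 > 0")
    case True
    have "H1 * \<Delta>\<^sup>2 \<le> \<Delta> * (H0 + H1 * \<Delta>)"
      using assms H_nonneg by (simp add: power2_eq_square algebra_simps)
    then have "32 * (18 + 12 * sqrt 2) * (H1 * \<Delta>\<^sup>2) \<le> 32 * C_star H1 * (\<Delta> * (H0 + H1 * \<Delta>))"
      using True nn H_nonneg by - (rule mult_mono, auto simp: C_star_def)
    then show ?thesis using assms by (simp add: grad_level_sq mult_ac)
  qed (use H_nonneg in auto)
qed

lemma continuous_objective: "continuous_on UNIV f"
  using strong
  by (auto simp: strongly_convex_def continuous_on_eq_continuous_at intro: differentiable_imp_continuous_within)

lemma borel_measurable_excess [measurable]: "F \<in> borel_measurable borel"
  unfolding excess_def
  by (intro borel_measurable_diff borel_measurable_const borel_measurable_continuous_onI continuous_objective)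

text \<open>
  The gradient is a pointwise limit of difference quotients, because the two models sandwich
  these quotients.
\<close>

lemma borel_measurable_grad [measurable]: "grad \<in> borel_measurable borel"
proof (rule borel_measurable_euclidean_space[THEN iffD2], intro ballI)
  fix b :: 'a assume b: "b \<in> Basis"
  define q where "q n x = real (Suc n) * (F (x + (1 / real (Suc n)) *\<^sub>R b) - F x)" for n x
  show "(\<lambda>x. grad x \<bullet> b) \<in> borel_measurable borel"
  proof (rule borel_measurable_LIMSEQ_real)
    show "q n \<in> borel_measurable borel" for n unfolding q_def by measurable
    fix x :: 'a
    have inv0: "(\<lambda>n. 1 / real (Suc n)) \<longlonglongrightarrow> 0"
      by (rule LIMSEQ_Suc[OF lim_1_over_n])
    have n: "norm ((1 / real (Suc n)) *\<^sub>R b) = 1 / real (Suc n)" for n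
      using b by simp
    have up: "\<forall>\<^sub>F n in sequentially. q n x \<le> grad x \<bullet> b + (H0 + H1 * F x) * (1 / real (Suc n))"
    proof -
      have "(\<lambda>n. (18 + 12 * sqrt 2) * H1 * (1 / real (Suc n))\<^sup>2) \<longlonglongrightarrow> (18 + 12 * sqrt 2) * H1 * 0\<^sup>2"
        by (intro tendsto_intros inv0)
      then have "\<forall>\<^sub>F n in sequentially. (18 + 12 * sqrt 2) * H1 * (1 / real (Suc n))\<^sup>2 < 1"
        by (rule order_tendstoD) simp
      then show ?thesis
      proof eventually_elim
        case (elim n)
        define s where "s = 1 / real (Suc n)"
        have s: "0 < s" "real (Suc n) = 1 / s" by (auto simp: s_def)
        have "F (x + s *\<^sub>R b) \<le> F x + grad x \<bullet> (s *\<^sub>R b) + (H0 + H1 * F x) * s\<^sup>2"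
          using excess_upper[of "x + s *\<^sub>R b" x] elim n[of n] s by (simp flip: s_def)
        then have "1 / s * (F (x + s *\<^sub>R b) - F x) \<le> 1 / s * (s * (grad x \<bullet> b) + (H0 + H1 * F x) * s\<^sup>2)"
          using s by (intro mult_left_mono) auto
        also have "\<dots> = grad x \<bullet> b + (H0 + H1 * F x) * s"
          using s(1) by (simp add: field_simps power2_eq_square)
        finally show ?case unfolding q_def s(2) by (simp add: s_def)
      qed
    qed
    have low: "grad x \<bullet> b \<le> q n x" for n
    proof -
      define s where "s = 1 / real (Suc n)"
      have s: "0 < s" "real (Suc n) = 1 / s" by (auto simp: s_def)
      have "F (x + s *\<^sub>R b) \<ge> F x + s * (grad x \<bullet> b)"
        using excess_convex[of x "x + s *\<^sub>R b"] by simp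
      then have "1 / s * (F (x + s *\<^sub>R b) - F x) \<ge> 1 / s * (s * (grad x \<bullet> b))"
        using s by (intro mult_left_mono) auto
      then show ?thesis unfolding q_def s(2) using s(1) by simp
    qed
    have lim: "(\<lambda>n. grad x \<bullet> b + (H0 + H1 * F x) * (1 / real (Suc n))) \<longlonglongrightarrow> grad x \<bullet> b + (H0 + H1 * F x) * 0"
      by (intro tendsto_intros inv0)
    show "(\<lambda>n. q n x) \<longlonglongrightarrow> grad x \<bullet> b"
      by (rule tendsto_sandwich[OF _ up tendsto_const]) (use low lim in auto)
  qed
qed

end

section \<open>Clipping\<close>

lemma borel_measurable_clip [measurable]: "clip \<Lambda> \<in> borel_measurable borel"
  unfolding clip_def by measurable

lemma clip_eq_self: "norm v \<le> \<Lambda> \<Longrightarrow> clip \<Lambda> v = v"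
  by (cases "v = 0") (auto simp: clip_def min_def field_simps)

lemma clip_eq_rescale: "\<Lambda> < norm v \<Longrightarrow> clip \<Lambda> v = (\<Lambda> / norm v) *\<^sub>R v"
  by (cases "v = 0") (auto simp: clip_def min_def field_simps)

lemma norm_clip_le: "0 \<le> \<Lambda> \<Longrightarrow> norm (clip \<Lambda> v) \<le> \<Lambda>"
  by (cases "norm v \<le> \<Lambda>") (auto simp: clip_eq_self clip_eq_rescale)

text \<open>
  Clipping is the projection to the ball of radius \<open>\<Lambda>\<close>, which does not increase the distance to points of the
  ball.
\<close>

lemma norm_diff_clip_le:
  assumes "norm e \<le> \<Lambda>"
  shows "norm (e - clip \<Lambda> v) \<le> norm (v - e)"
proof (cases "norm v \<le> \<Lambda>")
  case True
  then show ?thesis by (simp add: clip_eq_self norm_minus_commute)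
next
  case False
  define c where "c = \<Lambda> / norm v"
  have \<Lambda>: "0 \<le> \<Lambda>" using norm_ge_zero assms by (rule order_trans)
  with False have v0: "0 < norm v" by linarith
  then have v: "\<Lambda> = c * norm v" by (simp add: c_def)
  have c: "0 \<le> c" "c \<le> 1" using False v0 \<Lambda> by (simp_all add: c_def)
  have "e \<bullet> v \<le> norm e * norm v" by (rule norm_cauchy_schwarz)
  also have "\<dots> \<le> c * norm v * norm v" using assms v by (intro mult_right_mono) auto
  finally have ev: "e \<bullet> v \<le> c * (norm v)\<^sup>2" by (simp add: power2_eq_square)
  have "c * (norm v)\<^sup>2 \<le> (norm v)\<^sup>2" using c by (simp add: mult_left_le_one_le)
  then have "0 \<le> (1 - c) * ((1 + c) * (norm v)\<^sup>2 - 2 * (e \<bullet> v))"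
    using c ev by (intro mult_nonneg_nonneg) (auto simp: algebra_simps)
  also have "\<dots> = (norm (v - e))\<^sup>2 - (norm (e - c *\<^sub>R v))\<^sup>2"
    unfolding power2_norm_eq_inner by (simp add: inner_diff inner_commute algebra_simps)
  finally have "(norm (e - c *\<^sub>R v))\<^sup>2 \<le> (norm (v - e))\<^sup>2" by linarith
  then have "norm (e - c *\<^sub>R v) \<le> norm (v - e)" by (rule power2_le_imp_le) (rule norm_ge_zero)
  then show ?thesis using False by (simp add: clip_eq_rescale c_def)
qed

text \<open>
  Clipping only acts when the noise exceeds \<open>\<Lambda> / 2\<close>, and there \<open>\<delta> \<le> (\<Lambda> / 2) powr (1 - p) * \<delta> powr p\<close>.
\<close>

lemma clip_bias:
  assumes p: "1 < p" "p \<le> 2" and \<Lambda>: "0 < \<Lambda>" and e: "norm e \<le> \<Lambda> / 2"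
  shows "norm (v - clip \<Lambda> v) \<le> 2 * \<Lambda> powr (1 - p) * norm (v - e) powr p"
proof (cases "norm v \<le> \<Lambda>")
  case True
  then show ?thesis by (simp add: clip_eq_self)
next
  case False
  define \<delta> where "\<delta> = norm (v - e)"
  have "norm v \<le> \<delta> + norm e" unfolding \<delta>_def using norm_triangle_sub[of v e] by simp
  then have \<delta>: "\<Lambda> / 2 \<le> \<delta>" "norm v - \<Lambda> \<le> \<delta>" "0 < \<delta>" using False e \<Lambda> by auto
  have "v - clip \<Lambda> v = (1 - \<Lambda> / norm v) *\<^sub>R v" using False by (simp add: clip_eq_rescale algebra_simps)
  then have "norm (v - clip \<Lambda> v) = \<bar>1 - \<Lambda> / norm v\<bar> * norm v" by simp
  also have "\<dots> = norm v - \<Lambda>" using False \<Lambda> by (cases "v = 0") (simp_all add: field_simps abs_if)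
  also have "\<dots> \<le> \<delta>" by fact
  also have "\<dots> = \<delta> powr (1 - p) * \<delta> powr p" using \<delta> by (simp flip: powr_add)
  also have "\<dots> \<le> (\<Lambda> / 2) powr (1 - p) * \<delta> powr p"
    using p \<Lambda> \<delta> by (intro mult_right_mono powr_mono2') auto
  also have "(\<Lambda> / 2) powr (1 - p) = \<Lambda> powr (1 - p) * 2 powr (p - 1)"
    using \<Lambda> by (simp add: powr_divide powr_diff)
  also have "\<dots> \<le> \<Lambda> powr (1 - p) * 2 powr 1"
    using p by (intro mult_left_mono powr_mono) auto
  finally show ?thesis by (simp add: \<delta>_def mult_ac mult_right_mono)
qed

lemma norm_diff_clip_le_level:
  assumes "0 \<le> \<Lambda>" "norm e \<le> \<Lambda> / 2"
  shows "norm (e - clip \<Lambda> v) \<le> 3 / 2 * \<Lambda>"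
  using norm_triangle_ineq4[of e "clip \<Lambda> v"] norm_clip_le[OF assms(1), of v] assms by simp

text \<open>
  Of the two factors \<open>norm (e - clip \<Lambda> v)\<close>, raised to \<open>2 - p\<close> and to \<open>p\<close>, the first one is bounded by the
  clipping level and the second one by the noise.
\<close>

lemma clip_second_moment:
  assumes p: "1 < p" "p \<le> 2" and \<Lambda>: "0 < \<Lambda>" and e: "norm e \<le> \<Lambda> / 2"
  shows "(norm (e - clip \<Lambda> v))\<^sup>2 \<le> 3 / 2 * \<Lambda> powr (2 - p) * norm (v - e) powr p"
proof (cases "e - clip \<Lambda> v = 0")
  case True
  then show ?thesis by simp
next
  case False
  define t where "t = norm (e - clip \<Lambda> v)"
  have t: "0 < t" "t \<le> norm (v - e)" "t \<le> 3 / 2 * \<Lambda>"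
    using False norm_diff_clip_le[of e \<Lambda> v] norm_diff_clip_le_level[of \<Lambda> e v] e \<Lambda> by (auto simp: t_def)
  have "t\<^sup>2 = t powr (2 - p) * t powr p" using t by (simp flip: powr_add add: powr_realpow)
  also have "\<dots> \<le> (3 / 2 * \<Lambda>) powr (2 - p) * norm (v - e) powr p"
    using t p by (intro mult_mono powr_mono2) auto
  also have "(3 / 2 * \<Lambda>) powr (2 - p) = (3 / 2) powr (2 - p) * \<Lambda> powr (2 - p)"
    using \<Lambda> by (subst powr_mult) auto
  also have "\<dots> \<le> (3 / 2) powr 1 * \<Lambda> powr (2 - p)"
    using p by (intro mult_right_mono powr_mono) auto
  finally show ?thesis by (simp add: t_def mult_right_mono)
qed

section \<open>An exponential bound for a single noise term\<close>

lemma exp_le_quadratic: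
  fixes x :: real
  assumes "\<bar>x\<bar> \<le> 1"
  shows "exp x \<le> 1 + x + x\<^sup>2"
proof (cases "0 \<le> x")
  case True
  then show ?thesis using assms exp_bound[of x] by auto
next
  case False
  define y where "y = - x"
  have y: "0 < y" "y \<le> 1" using False assms by (auto simp: y_def)
  have "1 + y \<le> exp y" by (rule exp_ge_add_one_self)
  then have "exp (- y) \<le> 1 / (1 + y)" using y by (simp add: exp_minus field_simps)
  also have "\<dots> \<le> 1 - y + y\<^sup>2"
  proof -
    have "(1 - y + y\<^sup>2) * (1 + y) = 1 + y ^ 3"
      by (simp add: algebra_simps power2_eq_square power3_eq_cube)
    then show ?thesis using y by (simp add: divide_le_eq)
  qed
  finally show ?thesis by (simp add: y_def)
qed

text \<open>
  Since \<open>a * norm \<theta>\<close> is small against \<open>D\<close>, the linear part of \<open>X\<close> dominates, and in \<open>exp\<close> the square of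
  the scaled \<open>X\<close> costs only a multiple of \<open>(norm \<theta>)\<^sup>2\<close>.
\<close>

lemma noise_term_bound:
  fixes \<theta> v :: "'a::real_inner"
  assumes D: "0 < D" and l: "1 \<le> l" and a: "0 \<le> a" "200 * l * a * \<Lambda> \<le> D"
    and v: "norm v \<le> D" and \<theta>: "norm \<theta> \<le> 3 / 2 * \<Lambda>"
  defines "X \<equiv> a * (\<theta> \<bullet> v) + a\<^sup>2 * (norm \<theta>)\<^sup>2"
  shows "\<bar>l / D\<^sup>2 * X\<bar> \<le> 1"
    and "l / D\<^sup>2 * (a\<^sup>2 * (norm \<theta>)\<^sup>2) + (l / D\<^sup>2 * X)\<^sup>2 \<le> 3 * l * (l / D\<^sup>2) * a\<^sup>2 * (norm \<theta>)\<^sup>2"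
proof -
  define s where "s = a * norm \<theta>"
  have s0: "0 \<le> s" using a by (simp add: s_def)
  have "l * s \<le> l * (a * (3 / 2 * \<Lambda>))"
    unfolding s_def using a l \<theta> by (intro mult_left_mono) auto
  also have "\<dots> = 3 / 400 * (200 * l * a * \<Lambda>)" by simp
  also have "\<dots> \<le> 3 / 400 * D" using a by (intro mult_left_mono) auto
  finally have ls: "l * s \<le> 3 / 400 * D" .
  moreover have "s \<le> l * s" using l s0 by (simp add: mult_le_cancel_right1)
  ultimately have s: "s \<le> 3 / 400 * D" by simp
  have "\<bar>a * (\<theta> \<bullet> v)\<bar> \<le> s * D"
  proof -
    have "\<bar>\<theta> \<bullet> v\<bar> \<le> norm \<theta> * norm v" by (rule Cauchy_Schwarz_ineq2)
    also have "\<dots> \<le> norm \<theta> * D" using v by (intro mult_left_mono) auto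
    finally show ?thesis using a by (simp add: abs_mult s_def mult.assoc mult_left_mono)
  qed
  moreover have "a\<^sup>2 * (norm \<theta>)\<^sup>2 = s * s" by (simp add: s_def power2_eq_square)
  moreover have "s * s \<le> s * (3 / 400 * D)" using s s0 by (intro mult_left_mono)
  moreover have "0 \<le> s * s" "s * (3 / 400 * D) = 3 / 400 * (s * D)" by simp_all
  ultimately have X: "\<bar>X\<bar> \<le> (1 + 3 / 400) * (s * D)" unfolding X_def distrib_right by linarith
  have "\<bar>l / D\<^sup>2 * X\<bar> = l / D\<^sup>2 * \<bar>X\<bar>" using l by (simp add: abs_mult)
  also have "\<dots> \<le> l / D\<^sup>2 * ((1 + 3 / 400) * (s * D))"
    using X l by (intro mult_left_mono) auto
  also have "\<dots> = (1 + 3 / 400) * (l * s) / D" using D by (simp add: power2_eq_square)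
  finally have lX: "\<bar>l / D\<^sup>2 * X\<bar> \<le> (1 + 3 / 400) * (l * s) / D" .
  also have "\<dots> \<le> 1" using ls D by simp
  finally show "\<bar>l / D\<^sup>2 * X\<bar> \<le> 1" .
  have "(l / D\<^sup>2 * X)\<^sup>2 \<le> ((1 + 3 / 400) * (l * s) / D)\<^sup>2"
    using lX by (metis abs_ge_zero power2_abs power_mono)
  also have "\<dots> = (1 + 3 / 400)\<^sup>2 * (l * l / D\<^sup>2 * s\<^sup>2)" using D
    by (simp add: power_mult_distrib power_divide power2_eq_square mult_ac)
  also have "\<dots> \<le> 2 * (l * l / D\<^sup>2 * s\<^sup>2)"
    using l by (intro mult_right_mono) (auto simp: power2_eq_square)
  finally have 1: "(l / D\<^sup>2 * X)\<^sup>2 \<le> 2 * (l * l / D\<^sup>2 * s\<^sup>2)" .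
  have "1 * (l / D\<^sup>2 * s\<^sup>2) \<le> l * (l / D\<^sup>2 * s\<^sup>2)"
    using l by (intro mult_right_mono) auto
  then have 2: "l / D\<^sup>2 * s\<^sup>2 \<le> l * l / D\<^sup>2 * s\<^sup>2" by simp
  have sq: "a\<^sup>2 * (norm \<theta>)\<^sup>2 = s\<^sup>2" by (simp add: s_def power_mult_distrib)
  have "l / D\<^sup>2 * (a\<^sup>2 * (norm \<theta>)\<^sup>2) + (l / D\<^sup>2 * X)\<^sup>2 \<le> l * l / D\<^sup>2 * s\<^sup>2 + 2 * (l * l / D\<^sup>2 * s\<^sup>2)"
    unfolding sq by (intro add_mono 1 2)
  also have "\<dots> = 3 * l * (l / D\<^sup>2) * a\<^sup>2 * (norm \<theta>)\<^sup>2"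
    by (simp add: s_def power_mult_distrib)
  finally show "l / D\<^sup>2 * (a\<^sup>2 * (norm \<theta>)\<^sup>2) + (l / D\<^sup>2 * X)\<^sup>2 \<le> 3 * l * (l / D\<^sup>2) * a\<^sup>2 * (norm \<theta>)\<^sup>2" .
qed

text \<open>
  The right-hand side is affine in \<open>(e - g) \<bullet> v\<close>, which has mean zero, and in the \<open>p\<close>-th power
  of the noise, which is the only moment under control.
\<close>

lemma exp_clipped_noise_le:
  fixes e g v :: "'a::euclidean_space"
  assumes p: "1 < p" "p \<le> 2" and \<Lambda>: "0 < \<Lambda>" and e: "norm e \<le> \<Lambda> / 2"
    and D: "0 < D" and l: "1 \<le> l" and a: "0 \<le> a" "200 * l * a * \<Lambda> \<le> D" and v: "norm v \<le> D"
  defines "\<theta> \<equiv> e - clip \<Lambda> g"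
  shows "exp (l / D\<^sup>2 * (a * (\<theta> \<bullet> v) + a\<^sup>2 * (norm \<theta>)\<^sup>2))
    \<le> 1 + l / D\<^sup>2 * a * ((e - g) \<bullet> v)
        + l / D\<^sup>2 * a * (2 * D * \<Lambda> powr (1 - p) + 9 / 2 * l * a * \<Lambda> powr (2 - p)) * norm (g - e) powr p"
proof -
  define k where "k = l / D\<^sup>2"
  define X where "X = a * (\<theta> \<bullet> v) + a\<^sup>2 * (norm \<theta>)\<^sup>2"
  define \<delta> where "\<delta> = norm (g - e) powr p"
  have k: "0 \<le> k" using l by (simp add: k_def)
  have \<theta>: "norm \<theta> \<le> 3 / 2 * \<Lambda>" unfolding \<theta>_def using \<Lambda> e by (intro norm_diff_clip_le_level) auto
  note N = noise_term_bound[OF D l a v \<theta>, folded k_def X_def]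
  have "exp (k * X) \<le> 1 + k * X + (k * X)\<^sup>2" using N(1) by (rule exp_le_quadratic)
  also have "\<dots> = 1 + k * a * (\<theta> \<bullet> v) + (k * (a\<^sup>2 * (norm \<theta>)\<^sup>2) + (k * X)\<^sup>2)"
    by (simp add: X_def algebra_simps)
  also have "\<dots> \<le> 1 + k * a * (\<theta> \<bullet> v) + 3 * l * k * a\<^sup>2 * (norm \<theta>)\<^sup>2"
    using N(2) by simp
  also have "\<theta> \<bullet> v = (e - g) \<bullet> v + (g - clip \<Lambda> g) \<bullet> v"
    by (simp add: \<theta>_def inner_diff_left)
  also have "k * a * \<dots> \<le> k * a * ((e - g) \<bullet> v + 2 * \<Lambda> powr (1 - p) * \<delta> * D)"
  proof -
    have "(g - clip \<Lambda> g) \<bullet> v \<le> norm (g - clip \<Lambda> g) * norm v" by (rule norm_cauchy_schwarz)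
    also have "\<dots> \<le> 2 * \<Lambda> powr (1 - p) * \<delta> * D"
      unfolding \<delta>_def using v D clip_bias[OF p \<Lambda> e, of g] by (intro mult_mono) auto
    finally show ?thesis using k a by (intro mult_left_mono) auto
  qed
  also have "3 * l * k * a\<^sup>2 * (norm \<theta>)\<^sup>2 \<le> 3 * l * k * a\<^sup>2 * (3 / 2 * \<Lambda> powr (2 - p) * \<delta>)"
    unfolding \<theta>_def \<delta>_def using k l clip_second_moment[OF p \<Lambda> e, of g] by (intro mult_left_mono) auto
  finally have "exp (k * X) \<le> 1 + k * a * ((e - g) \<bullet> v + 2 * \<Lambda> powr (1 - p) * \<delta> * D)
      + 3 * l * k * a\<^sup>2 * (3 / 2 * \<Lambda> powr (2 - p) * \<delta>)" by simp
  also have "\<dots> = 1 + k * a * ((e - g) \<bullet> v)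
      + k * a * (2 * D * \<Lambda> powr (1 - p) + 9 / 2 * l * a * \<Lambda> powr (2 - p)) * \<delta>"
    by (simp add: algebra_simps power2_eq_square)
  finally show ?thesis by (simp add: k_def X_def \<delta>_def)
qed

section \<open>One iteration of a phase\<close>

text \<open>
  A displacement \<open>s \<le> \<eta>\<close> is within the radius of the upper model, and its quadratic term is
  negligible against \<open>\<Delta>\<close>.
\<close>

context objective
begin

lemma radius_ok:
  assumes "0 < \<Delta>" "0 \<le> s" "s \<le> \<eta>" "2 * grad_level H0 H1 \<Delta> * \<eta> \<le> \<Delta>"
  shows "(18 + 12 * sqrt 2) * H1 * s\<^sup>2 \<le> 1"
    and "(H0 + H1 * \<Delta>) * s\<^sup>2 \<le> \<Delta> / 256"
proof -
  define G where "G = grad_level H0 H1 \<Delta>"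
  have G: "0 < G" unfolding G_def using assms by (intro grad_level_pos)
  have "G * s \<le> G * \<eta>" using assms G by (intro mult_left_mono) auto
  then have Gs: "G * s \<le> \<Delta> / 2" using assms by (simp add: G_def)
  have "(G * s)\<^sup>2 \<le> (\<Delta> / 2)\<^sup>2" using Gs G assms by (intro power_mono) auto
  then have Gs2: "G\<^sup>2 * s\<^sup>2 \<le> \<Delta>\<^sup>2 / 4" by (simp add: power_mult_distrib power_divide)
  have "32 * (18 + 12 * sqrt 2) * H1 * \<Delta>\<^sup>2 * s\<^sup>2 \<le> G\<^sup>2 * s\<^sup>2"
    unfolding G_def using assms by (intro mult_right_mono grad_level_sq_ge) auto
  then have "32 * (\<Delta>\<^sup>2 * ((18 + 12 * sqrt 2) * H1 * s\<^sup>2)) \<le> G\<^sup>2 * s\<^sup>2"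
    by (simp only: mult_ac)
  with Gs2 have "\<Delta>\<^sup>2 * ((18 + 12 * sqrt 2) * H1 * s\<^sup>2) \<le> \<Delta>\<^sup>2 * 1"
    using zero_le_power2[of \<Delta>] by linarith
  then show "(18 + 12 * sqrt 2) * H1 * s\<^sup>2 \<le> 1"
    using assms by (simp only: mult_le_cancel_left_pos zero_less_power)
  have "64 * \<Delta> * (H0 + H1 * \<Delta>) * s\<^sup>2 \<le> G\<^sup>2 * s\<^sup>2"
    unfolding G_def using assms by (intro mult_right_mono grad_level_sq_ge) auto
  then have "64 * (\<Delta> * ((H0 + H1 * \<Delta>) * s\<^sup>2)) \<le> G\<^sup>2 * s\<^sup>2"
    by (simp only: mult_ac)
  moreover have "\<Delta> * (\<Delta> / 256) = \<Delta>\<^sup>2 / 256" by (simp add: power2_eq_square)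
  ultimately have "\<Delta> * ((H0 + H1 * \<Delta>) * s\<^sup>2) \<le> \<Delta> * (\<Delta> / 256)"
    using Gs2 by linarith
  then show "(H0 + H1 * \<Delta>) * s\<^sup>2 \<le> \<Delta> / 256"
    using assms by (simp only: mult_le_cancel_left_pos)
qed

lemma curvature_le:
  assumes "F x \<le> 4 * \<Delta>"
  shows "H0 + H1 * F x \<le> 4 * (H0 + H1 * \<Delta>)"
proof -
  have "H1 * F x \<le> H1 * (4 * \<Delta>)" using assms H_nonneg by (intro mult_left_mono)
  then show ?thesis using H_nonneg by (simp add: algebra_simps)
qed

text \<open>
  The upper model at \<open>y\<close> adds at most \<open>\<Delta> / 2\<close> through its linear and \<open>\<Delta> / 64\<close> through its quadratic
  term.
\<close>

lemma query_excess_le: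
  assumes "0 < \<Delta>" and \<eta>: "2 * grad_level H0 H1 \<Delta> * \<eta> \<le> \<Delta>"
    and y: "F y \<le> 3 * \<Delta>" and u: "norm (u - y) \<le> \<eta>"
  shows "F u \<le> 4 * \<Delta>"
proof -
  define s where "s = norm (u - y)"
  have s: "0 \<le> s" "s \<le> \<eta>" using u by (auto simp: s_def)
  note R = radius_ok[OF assms(1) s \<eta>]
  have y4: "F y \<le> 4 * \<Delta>" using y assms(1) by simp
  have "F u \<le> F y + grad y \<bullet> (u - y) + (H0 + H1 * F y) * s\<^sup>2"
    unfolding s_def by (intro excess_upper) (use R in \<open>simp add: s_def\<close>)
  also have "grad y \<bullet> (u - y) \<le> grad_level H0 H1 \<Delta> * \<eta>"
  proof -
    have "grad y \<bullet> (u - y) \<le> norm (grad y) * norm (u - y)" by (rule norm_cauchy_schwarz)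
    also have "\<dots> \<le> grad_level H0 H1 \<Delta> * \<eta>"
      using norm_grad_le_grad_level[OF y4] u grad_level_pos[OF assms(1)] by (intro mult_mono) auto
    finally show ?thesis .
  qed
  also have "(H0 + H1 * F y) * s\<^sup>2 \<le> 4 * (H0 + H1 * \<Delta>) * s\<^sup>2"
    by (intro mult_right_mono curvature_le y4) auto
  finally show ?thesis using R(2) y \<eta> assms(1) by (simp only: mult.assoc) linarith
qed

text \<open>
  The usual estimate for the method of similar triangles. The error of the gradient estimate
  contributes a linear term in the known point \<open>z\<close> and, after completing the square against
  the movement \<open>z' - z\<close>, a quadratic one.
\<close>

lemma similar_triangles_step:
  assumes \<Delta>: "0 < \<Delta>" and D: "0 < D" and \<eta>: "0 < \<eta>" "2 * grad_level H0 H1 \<Delta> * \<eta> \<le> \<Delta>"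
    and Q: "convex Q" "closed Q" "xs \<in> Q"
    and A: "0 \<le> A" "A' = A + a" "D\<^sup>2 / \<Delta> \<le> A'" and a: "a = \<eta> * D / \<Delta>"
    and u: "A' *\<^sub>R u = A *\<^sub>R y + a *\<^sub>R z" and y': "A' *\<^sub>R y' = A *\<^sub>R y + a *\<^sub>R z'"
    and Fu: "F u \<le> 4 * \<Delta>"
    and z': "z' = closest_point Q (z - a *\<^sub>R c)" "norm (z' - z) \<le> D"
  defines "\<theta> \<equiv> grad u - c"
  shows "A' * F y' + 1 / 2 * (norm (z' - xs))\<^sup>2
    \<le> A * F y + 1 / 2 * (norm (z - xs))\<^sup>2 + (a * (\<theta> \<bullet> (z - xs)) + a\<^sup>2 * (norm \<theta>)\<^sup>2)"
proof -
  define e where "e = grad u"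
  define h where "h = H0 + H1 * F u"
  define n where "n = norm (z' - z)"
  have apos: "0 < a" using a \<eta> D \<Delta> by simp
  have A': "0 < A'" using A apos by simp
  have ratio: "a / A' \<le> \<eta> / D"
  proof -
    have "a / A' \<le> a / (D\<^sup>2 / \<Delta>)" using A apos D \<Delta> A' by (intro divide_left_mono) auto
    also have "\<dots> = \<eta> / D" using a D \<Delta> by (simp add: power2_eq_square)
    finally show ?thesis .
  qed
  have "A' *\<^sub>R (y' - u) = a *\<^sub>R (z' - z)"
    using u y' by (simp add: scaleR_diff_right)
  then have "inverse A' *\<^sub>R (A' *\<^sub>R (y' - u)) = inverse A' *\<^sub>R (a *\<^sub>R (z' - z))" by simp
  then have move: "y' - u = (a / A') *\<^sub>R (z' - z)"
    using A' by (simp add: field_simps)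
  have len: "norm (y' - u) = a / A' * n" using apos A' by (simp add: move n_def)
  have "a / A' * n \<le> \<eta> / D * D"
    using ratio z'(2) apos A' \<eta> D by (intro mult_mono) (auto simp: n_def)
  then have short: "norm (y' - u) \<le> \<eta>" using len D by simp
  have up: "F y' \<le> F u + e \<bullet> (y' - u) + h * (a / A' * n)\<^sup>2"
    unfolding e_def h_def len[symmetric]
    by (rule excess_upper) (rule radius_ok[OF \<Delta> norm_ge_zero short \<eta>(2)])
  have quad: "A' * (h * (a / A' * n)\<^sup>2) \<le> 1 / 4 * n\<^sup>2"
  proof -
    have "(H0 + H1 * \<Delta>) * \<eta>\<^sup>2 \<le> \<Delta> / 256"
      using \<eta> by (intro radius_ok[OF \<Delta> _ _ \<eta>(2)]) auto
    moreover have "h * \<eta>\<^sup>2 \<le> 4 * (H0 + H1 * \<Delta>) * \<eta>\<^sup>2"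
      unfolding h_def by (intro mult_right_mono curvature_le Fu) auto
    ultimately have h: "h * \<eta>\<^sup>2 \<le> \<Delta> / 64" by (simp only: mult.assoc)
    have "A' * (h * (a / A' * n)\<^sup>2) = h * (a * (a / A')) * n\<^sup>2"
      using A' by (simp add: power2_eq_square field_simps)
    also have "\<dots> \<le> h * (a * (\<eta> / D)) * n\<^sup>2"
      unfolding h_def using ratio apos curvature_nonneg[of u] by (intro mult_right_mono mult_left_mono) auto
    also have "h * (a * (\<eta> / D)) = h * \<eta>\<^sup>2 / \<Delta>"
      using a D \<Delta> by (simp add: power2_eq_square)
    also have "\<dots> * n\<^sup>2 \<le> 1 / 4 * n\<^sup>2"
      using h \<Delta> by (intro mult_right_mono) (auto simp: field_simps)
    finally show ?thesis .
  qed
  have "A' * F y' \<le> A' * F u + e \<bullet> (A' *\<^sub>R (y' - u)) + A' * (h * (a / A' * n)\<^sup>2)"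
    using mult_left_mono[OF up, of A'] A' by (simp add: algebra_simps)
  also have "A' *\<^sub>R (y' - u) = a *\<^sub>R (z' - z)" by fact
  finally have 1: "A' * F y' \<le> A' * F u + a * (e \<bullet> (z' - z)) + 1 / 4 * n\<^sup>2"
    using quad by simp
  \<comment> \<open>the lower models at \<open>u\<close> for \<open>y\<close> and \<open>xs\<close>, with weights \<open>A\<close> and \<open>a\<close>; \<open>u\<close> is the weighted mean of \<open>y\<close> and \<open>z\<close>\<close>
  have 2: "A' * F u \<le> A * F y + a * (e \<bullet> (z - xs))"
  proof -
    have "A * (F u + e \<bullet> (y - u)) \<le> A * F y"
      unfolding e_def using A by (intro mult_left_mono excess_convex) auto
    moreover have "a * (F u + e \<bullet> (xs - u)) \<le> a * 0"
      using excess_convex[of u xs] apos by (intro mult_left_mono) (auto simp: e_def)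
    moreover have "e \<bullet> (A *\<^sub>R y + a *\<^sub>R z) = e \<bullet> (A' *\<^sub>R u)" by (simp only: u)
    ultimately show ?thesis by (simp add: A(2) inner_diff_right inner_add_right algebra_simps)
  qed
  \<comment> \<open>optimality of the projection\<close>
  have "(z - a *\<^sub>R c - z') \<bullet> (xs - z') \<le> 0"
    unfolding z'(1) by (rule closest_point_dot[OF Q])
  moreover have "(norm (z - xs))\<^sup>2 = (norm (z' - xs))\<^sup>2 + n\<^sup>2 - 2 * ((z - z') \<bullet> (xs - z'))"
    by (simp add: n_def power2_norm_eq_inner inner_diff inner_commute algebra_simps)
  ultimately have 3: "a * (c \<bullet> (z' - xs)) \<le> 1 / 2 * (norm (z - xs))\<^sup>2 - 1 / 2 * (norm (z' - xs))\<^sup>2 - 1 / 2 * n\<^sup>2"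
    by (simp add: inner_diff inner_commute algebra_simps)
  have 4: "a * (\<theta> \<bullet> (z' - z)) \<le> a\<^sup>2 * (norm \<theta>)\<^sup>2 + 1 / 4 * n\<^sup>2"
  proof -
    have "0 \<le> (norm (a *\<^sub>R \<theta> - (1 / 2) *\<^sub>R (z' - z)))\<^sup>2" by simp
    also have "\<dots> = a\<^sup>2 * (norm \<theta>)\<^sup>2 + 1 / 4 * n\<^sup>2 - a * (\<theta> \<bullet> (z' - z))"
      unfolding n_def power2_norm_eq_inner
      by (simp add: inner_diff inner_commute algebra_simps power2_eq_square)
    finally show ?thesis by simp
  qed
  have 5: "a * (e \<bullet> (z' - z)) + a * (e \<bullet> (z - xs)) =
      a * (c \<bullet> (z' - xs)) + a * (\<theta> \<bullet> (z - xs)) + a * (\<theta> \<bullet> (z' - z))"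
    by (simp add: \<theta>_def e_def inner_diff algebra_simps)
  show ?thesis using 1 2 3 4 5 by simp
qed

end

section \<open>Moments of the stochastic oracle\<close>

locale oracle_objective = objective f \<mu> H0 H1 xs
  for f :: "'a::euclidean_space \<Rightarrow> real" and \<mu> H0 H1 :: real and xs +
  fixes p \<sigma>0 \<sigma>1 \<sigma>2 :: real and M :: "'w measure" and \<Xi> :: "'b measure" and \<xi> and g
  assumes sampling: "stochastic_oracle p \<sigma>0 \<sigma>1 \<sigma>2 f M \<Xi> \<xi> g"
begin

abbreviation Fil where "Fil \<equiv> sample_filtration M \<Xi> \<xi>"

lemma p_range: "1 < p" "p \<le> 2"
  using sampling by (simp_all add: stochastic_oracle_def)

lemma sigma_nonneg: "0 \<le> \<sigma>0" "0 \<le> \<sigma>1" "0 \<le> \<sigma>2"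
  using sampling by (simp_all add: stochastic_oracle_def)

lemma sample_measurable: "1 \<le> t \<Longrightarrow> \<xi> t \<in> measurable M \<Xi>"
  using sampling by (simp add: stochastic_oracle_def)

lemma oracle_measurable [measurable]: "(\<lambda>(x, z). g x z) \<in> borel_measurable (borel \<Otimes>\<^sub>M \<Xi>)"
  using sampling by (simp add: stochastic_oracle_def)

sublocale prob_space M
  using sampling by (simp add: stochastic_oracle_def)

lemma space_Fil [simp]: "space (Fil t) = space M"
  by (simp add: sample_filtration_def space_measure_of_conv)

lemma sets_Fil: "sets (Fil t) =
    sigma_sets (space M) (\<Union>i\<in>{1..t}. {\<xi> i -` A \<inter> space M | A. A \<in> sets \<Xi>})"
  unfolding sample_filtration_def by (rule sets_measure_of) auto

lemma Fil_mono: "s \<le> t \<Longrightarrow> sets (Fil s) \<subseteq> sets (Fil t)"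
  unfolding sets_Fil by (intro sigma_sets_mono') force

lemma measurable_Fil_mono: "s \<le> t \<Longrightarrow> h \<in> measurable (Fil s) N \<Longrightarrow> h \<in> measurable (Fil t) N"
  using Fil_mono[of s t] by (auto simp: measurable_def)

lemma subalgebra_Fil: "subalgebra M (Fil t)"
proof -
  have "sets (Fil t) \<subseteq> sets M"
    unfolding sets_Fil
    by (intro sets.sigma_sets_subset) (auto intro: measurable_sets[OF sample_measurable])
  then show ?thesis by (simp add: subalgebra_def)
qed

lemma measurable_Fil_imp: "h \<in> measurable (Fil t) N \<Longrightarrow> h \<in> measurable M N"
  by (rule measurable_from_subalg[OF subalgebra_Fil])

lemma sample_measurable_Fil: "1 \<le> t \<Longrightarrow> \<xi> t \<in> measurable (Fil t) \<Xi>"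
proof (rule measurableI)
  fix w assume "1 \<le> t" "w \<in> space (Fil t)"
  then show "\<xi> t w \<in> space \<Xi>" using measurable_space[OF sample_measurable] by simp
next
  fix A assume "1 \<le> t" "A \<in> sets \<Xi>"
  then have "\<xi> t -` A \<inter> space M \<in> (\<Union>i\<in>{1..t}. {\<xi> i -` A \<inter> space M | A. A \<in> sets \<Xi>})" by force
  then show "\<xi> t -` A \<inter> space (Fil t) \<in> sets (Fil t)"
    unfolding sets_Fil space_Fil by (rule sigma_sets.Basic)
qed

lemma Fil_cond: "sigma_finite_subalgebra M (Fil t)"
  by (intro finite_measure_subalgebra_is_sigma_finite finite_measure_subalgebra.intro
      finite_measure_subalgebra_axioms.intro subalgebra_Fil) unfold_locales

end

text \<open>
  The level bound holds at every point of the sample space, because a query can be replaced by the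
  minimizer where it leaves the level. It turns the conditional moment bound into a constant
  and makes the answers integrable.
\<close>

locale bounded_query = oracle_objective f \<mu> H0 H1 xs p \<sigma>0 \<sigma>1 \<sigma>2 M \<Xi> \<xi> g
  for f :: "'a::euclidean_space \<Rightarrow> real" and \<mu> H0 H1 :: real and xs and p \<sigma>0 \<sigma>1 \<sigma>2 :: real
    and M :: "'w measure" and \<Xi> :: "'b measure" and \<xi> and g +
  fixes \<Delta> :: real and t :: nat and x :: "'w \<Rightarrow> 'a"
  assumes t: "1 \<le> t" and \<Delta>: "0 < \<Delta>"
    and query: "x \<in> borel_measurable (sample_filtration M \<Xi> \<xi> (t - 1))"
    and level: "\<And>w. excess f (x w) \<le> 4 * \<Delta>"
begin

abbreviation answer where "answer \<equiv> \<lambda>w. g (x w) (\<xi> t w)"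
abbreviation noise_pow where "noise_pow \<equiv> \<lambda>w. norm (answer w - grad (x w)) powr p"
abbreviation noise_bound where "noise_bound \<equiv> noise_level_pow p H0 H1 \<sigma>0 \<sigma>1 \<sigma>2 \<Delta>"

lemma query_M [measurable]: "x \<in> borel_measurable M"
  by (rule measurable_Fil_imp[OF query])

lemma answer_measurable [measurable]: "answer \<in> borel_measurable M"
proof -
  have [measurable]: "\<xi> t \<in> measurable M \<Xi>" using t by (rule sample_measurable)
  have "(\<lambda>w. (\<lambda>(x, z). g x z) (x w, \<xi> t w)) \<in> borel_measurable M" by measurable
  then show ?thesis by simp
qed

lemma noise_bound_nonneg: "0 \<le> noise_bound"
  by (simp add: noise_level_pow_def)

lemma norm_grad_query_le: "norm (grad (x w)) \<le> grad_level H0 H1 \<Delta>"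
  by (rule norm_grad_le_grad_level[OF level])

lemma nn_cond_noise_le:
  "AE w in M. nn_cond_exp M (Fil (t - 1)) (\<lambda>w. ennreal (noise_pow w)) w \<le> ennreal noise_bound"
proof -
  have "AE w in M. nn_cond_exp M (Fil (t - 1)) (\<lambda>w. ennreal (noise_pow w)) w
      \<le> ennreal (\<sigma>0 powr p + \<sigma>1 powr p * norm (grad (x w)) powr p + \<sigma>2 powr p * F (x w) powr (p / 2))"
    using sampling t query by (simp add: stochastic_oracle_def)
  then show ?thesis
  proof eventually_elim
    case (elim w)
    have "\<sigma>0 powr p + \<sigma>1 powr p * norm (grad (x w)) powr p + \<sigma>2 powr p * F (x w) powr (p / 2) \<le> noise_bound"
      unfolding noise_level_pow_def
      using p_range sigma_nonneg level[of w] excess_nonneg[of "x w"]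
      by (intro add_mono mult_left_mono powr_mono2 norm_grad_query_le) auto
    with elim show ?case by (meson ennreal_leI order_trans)
  qed
qed

lemma nn_integral_weighted_noise_le:
  assumes [measurable]: "W \<in> borel_measurable (Fil (t - 1))"
  shows "(\<integral>\<^sup>+w. W w * ennreal (noise_pow w) \<partial>M) \<le> (\<integral>\<^sup>+w. W w * ennreal noise_bound \<partial>M)"
proof -
  interpret C: sigma_finite_subalgebra M "Fil (t - 1)" by (rule Fil_cond)
  have "(\<integral>\<^sup>+w. W w * ennreal (noise_pow w) \<partial>M)
      = (\<integral>\<^sup>+w. W w * nn_cond_exp M (Fil (t - 1)) (\<lambda>w. ennreal (noise_pow w)) w \<partial>M)"
    by (rule C.nn_cond_exp_intg[symmetric]) measurable
  also have "\<dots> \<le> (\<integral>\<^sup>+w. W w * ennreal noise_bound \<partial>M)"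
  proof (rule nn_integral_mono_AE)
    show "AE w in M. W w * nn_cond_exp M (Fil (t - 1)) (\<lambda>w. ennreal (noise_pow w)) w \<le> W w * ennreal noise_bound"
      using nn_cond_noise_le by eventually_elim (rule mult_left_mono, auto)
  qed
  finally show ?thesis .
qed

lemma integrable_noise_pow: "integrable M noise_pow"
proof (rule integrableI_bounded)
  have "(\<integral>\<^sup>+w. ennreal (norm (noise_pow w)) \<partial>M) = (\<integral>\<^sup>+w. 1 * ennreal (noise_pow w) \<partial>M)" by simp
  also have "\<dots> \<le> (\<integral>\<^sup>+w. 1 * ennreal noise_bound \<partial>M)"
    by (rule nn_integral_weighted_noise_le) simp
  also have "\<dots> < \<infinity>" by (simp add: emeasure_space_1)
  finally show "(\<integral>\<^sup>+w. ennreal (norm (noise_pow w)) \<partial>M) < \<infinity>" .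
qed measurable

text \<open>
  The conditional moment bound in integrated form, tested against a weight known before the sample
  is drawn.
\<close>

lemma weighted_noise_le:
  assumes W [measurable]: "W \<in> borel_measurable (Fil (t - 1))" and W0: "\<And>w. 0 \<le> W w" and WK: "\<And>w. W w \<le> K"
  shows "integrable M (\<lambda>w. W w * noise_pow w)"
    and "(\<integral>w. W w * noise_pow w \<partial>M) \<le> noise_bound * (\<integral>w. W w \<partial>M)"
proof -
  have [measurable]: "W \<in> borel_measurable M" by (rule measurable_Fil_imp[OF W])
  have intW: "integrable M W" using W0 WK by (intro integrable_const_bound[of _ K]) auto
  show int: "integrable M (\<lambda>w. W w * noise_pow w)"
  proof (rule Bochner_Integration.integrable_bound)
    show "integrable M (\<lambda>w. K * noise_pow w)" using integrable_noise_pow by simp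
    show "AE w in M. norm (W w * noise_pow w) \<le> norm (K * noise_pow w)"
      using W0 WK order_trans[OF W0 WK] by (auto simp: abs_mult intro!: mult_right_mono)
  qed measurable
  have "ennreal (\<integral>w. W w * noise_pow w \<partial>M) = (\<integral>\<^sup>+w. ennreal (W w) * ennreal (noise_pow w) \<partial>M)"
    using int W0 by (subst nn_integral_eq_integral[symmetric]) (auto simp: ennreal_mult)
  also have "\<dots> \<le> (\<integral>\<^sup>+w. ennreal (W w) * ennreal noise_bound \<partial>M)"
    by (rule nn_integral_weighted_noise_le) measurable
  also have "\<dots> = (\<integral>\<^sup>+w. ennreal (noise_bound * W w) \<partial>M)"
    using W0 noise_bound_nonneg by (simp add: ennreal_mult mult.commute)
  also have "\<dots> = ennreal (\<integral>w. noise_bound * W w \<partial>M)"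
    using intW W0 noise_bound_nonneg by (intro nn_integral_eq_integral) auto
  finally show "(\<integral>w. W w * noise_pow w \<partial>M) \<le> noise_bound * (\<integral>w. W w \<partial>M)"
    using noise_bound_nonneg W0 by (simp add: ennreal_le_iff)
qed

lemma integrable_grad_query: "integrable M (\<lambda>w. grad (x w))"
  using norm_grad_query_le by (intro integrable_const_bound[of _ "grad_level H0 H1 \<Delta>"]) auto

lemma integrable_answer: "integrable M answer"
proof -
  have "integrable M (\<lambda>w. answer w - grad (x w))"
  proof (rule Bochner_Integration.integrable_bound)
    show "integrable M (\<lambda>w. 1 + noise_pow w)" using integrable_noise_pow by simp
    have "n \<le> 1 + n powr p" if "0 \<le> n" for n :: real
    proof (cases "n \<le> 1")
      case True
      then show ?thesis using that by (smt (verit) powr_ge_zero)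
    next
      case False
      then have "n powr 1 \<le> n powr p" using p_range by (intro powr_mono) auto
      then show ?thesis using that by simp
    qed
    then show "AE w in M. norm (answer w - grad (x w)) \<le> norm (1 + noise_pow w)"
      by (intro AE_I2) (simp add: add_nonneg_nonneg)
  qed measurable
  from Bochner_Integration.integrable_add[OF this integrable_grad_query] show ?thesis by simp
qed

text \<open>
  The conditional mean is given coordinatewise, so the inner product is expanded over the basis.
\<close>

lemma noise_orthogonal:
  assumes V [measurable]: "V \<in> borel_measurable (Fil (t - 1))" and VK: "\<And>w. norm (V w) \<le> K"
  shows "integrable M (\<lambda>w. (grad (x w) - answer w) \<bullet> V w)"
    and "(\<integral>w. (grad (x w) - answer w) \<bullet> V w \<partial>M) = 0"
proof -
  interpret C: sigma_finite_subalgebra M "Fil (t - 1)" by (rule Fil_cond)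
  have [measurable]: "V \<in> borel_measurable M" by (rule measurable_Fil_imp[OF V])
  have int: "integrable M (\<lambda>w. (V w \<bullet> b) * (Y w \<bullet> b))"
    if "integrable M Y" "b \<in> Basis" for Y :: "'w \<Rightarrow> 'a" and b
  proof (rule Bochner_Integration.integrable_bound)
    show "integrable M (\<lambda>w. K * norm (Y w))" using that by simp
    have [measurable]: "Y \<in> borel_measurable M" using that by auto
    show "(\<lambda>w. (V w \<bullet> b) * (Y w \<bullet> b)) \<in> borel_measurable M" by measurable
    have K: "0 \<le> K" using VK order_trans[OF norm_ge_zero] by blast
    have "\<bar>V w \<bullet> b\<bar> * \<bar>Y w \<bullet> b\<bar> \<le> K * norm (Y w)" for w
      using Basis_le_norm[OF that(2)] VK[of w] K by (intro mult_mono) (auto intro: order_trans)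
    then show "AE w in M. norm ((V w \<bullet> b) * (Y w \<bullet> b)) \<le> norm (K * norm (Y w))"
      using K by (simp add: abs_mult)
  qed
  have coord: "(\<integral>w. (V w \<bullet> b) * (answer w \<bullet> b) \<partial>M) = (\<integral>w. (V w \<bullet> b) * (grad (x w) \<bullet> b) \<partial>M)"
    if b: "b \<in> Basis" for b
  proof -
    have "(\<integral>w. (V w \<bullet> b) * (answer w \<bullet> b) \<partial>M)
        = (\<integral>w. (V w \<bullet> b) * real_cond_exp M (Fil (t - 1)) (\<lambda>w. answer w \<bullet> b) w \<partial>M)"
      by (rule C.real_cond_exp_intg(2)[symmetric]) (use int[OF integrable_answer b] in measurable)
    also have "\<dots> = (\<integral>w. (V w \<bullet> b) * (grad (x w) \<bullet> b) \<partial>M)"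
    proof (rule integral_cong_AE)
      have "AE w in M. \<forall>b\<in>Basis. real_cond_exp M (Fil (t - 1)) (\<lambda>w. answer w \<bullet> b) w = grad (x w) \<bullet> b"
        using sampling t query by (simp add: stochastic_oracle_def)
      then show "AE w in M. (V w \<bullet> b) * real_cond_exp M (Fil (t - 1)) (\<lambda>w. answer w \<bullet> b) w
          = (V w \<bullet> b) * (grad (x w) \<bullet> b)"
        by eventually_elim (use b in simp)
    qed measurable
    finally show ?thesis .
  qed
  have split: "(grad (x w) - answer w) \<bullet> V w
      = (\<Sum>b\<in>Basis. (V w \<bullet> b) * (grad (x w) \<bullet> b) - (V w \<bullet> b) * (answer w \<bullet> b))" for w
    by (subst euclidean_inner) (simp add: inner_diff_left algebra_simps)
  show "integrable M (\<lambda>w. (grad (x w) - answer w) \<bullet> V w)"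
    unfolding split using int[OF integrable_answer] int[OF integrable_grad_query] by auto
  show "(\<integral>w. (grad (x w) - answer w) \<bullet> V w \<partial>M) = 0"
    unfolding split using int[OF integrable_answer] int[OF integrable_grad_query] coord
    by (subst Bochner_Integration.integral_sum) (auto simp: Bochner_Integration.integral_diff)
qed

text \<open>
  One step of the exponential supermartingale. Integrating the pointwise bound
  \<open>exp_clipped_noise_le\<close> against \<open>W\<close> removes the linear term, which is a martingale difference.
\<close>

lemma exponential_step:
  assumes \<Lambda>: "0 < \<Lambda>" "2 * grad_level H0 H1 \<Delta> \<le> \<Lambda>"
    and D: "0 < D" and l: "1 \<le> l" and a: "0 \<le> a" "200 * l * a * \<Lambda> \<le> D"
    and v [measurable]: "v \<in> borel_measurable (Fil (t - 1))" and vD: "\<And>w. norm (v w) \<le> D"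
    and W [measurable]: "W \<in> borel_measurable (Fil (t - 1))" and W0: "\<And>w. 0 \<le> W w" and WK: "\<And>w. W w \<le> K"
  defines "\<theta> \<equiv> \<lambda>w. grad (x w) - clip \<Lambda> (answer w)"
  defines "E \<equiv> \<lambda>w. W w * exp (l / D\<^sup>2 * (a * (\<theta> w \<bullet> v w) + a\<^sup>2 * (norm (\<theta> w))\<^sup>2))"
  shows "integrable M E"
    and "(\<integral>w. E w \<partial>M) \<le> (1 + l / D\<^sup>2 * a * (2 * D * \<Lambda> powr (1 - p) + 9 / 2 * l * a * \<Lambda> powr (2 - p)) * noise_bound)
        * (\<integral>w. W w \<partial>M)"
proof -
  have [measurable]: "v \<in> borel_measurable M" "W \<in> borel_measurable M"
    by (rule measurable_Fil_imp, fact)+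
  have K: "0 \<le> K" using order_trans[OF W0 WK] .
  have e: "norm (grad (x w)) \<le> \<Lambda> / 2" for w using norm_grad_query_le[of w] \<Lambda> by simp
  define k where "k = l / D\<^sup>2 * a * (2 * D * \<Lambda> powr (1 - p) + 9 / 2 * l * a * \<Lambda> powr (2 - p))"
  have k: "0 \<le> k" using l a D by (auto simp: k_def)
  have \<theta>: "norm (\<theta> w) \<le> 3 / 2 * \<Lambda>" for w
    unfolding \<theta>_def using \<Lambda> e by (intro norm_diff_clip_le_level) auto
  show intE: "integrable M E"
  proof (rule integrable_const_bound[of _ "K * exp 1"])
    show "AE w in M. norm (E w) \<le> K * exp 1"
    proof (rule AE_I2)
      fix w
      have "l / D\<^sup>2 * (a * (\<theta> w \<bullet> v w) + a\<^sup>2 * (norm (\<theta> w))\<^sup>2) \<le> 1"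
        using noise_term_bound(1)[OF D l a vD \<theta>, of w w] by (rule abs_le_D1)
      then show "norm (E w) \<le> K * exp 1"
        unfolding E_def using W0[of w] WK[of w] K by (simp add: abs_mult mult_mono)
    qed
    show "E \<in> borel_measurable M" unfolding E_def \<theta>_def by measurable
  qed
  have intW: "integrable M W" using W0 WK by (intro integrable_const_bound[of _ K]) auto
  have V: "(\<lambda>w. W w *\<^sub>R v w) \<in> borel_measurable (Fil (t - 1))" by measurable
  have VK: "norm (W w *\<^sub>R v w) \<le> K * D" for w
    using W0[of w] WK[of w] K vD[of w] by (simp add: mult_mono)
  note orth = noise_orthogonal[OF V VK]
  note noise = weighted_noise_le[OF W W0 WK]
  define U where "U w = W w + l / D\<^sup>2 * a * ((grad (x w) - answer w) \<bullet> (W w *\<^sub>R v w)) + k * (W w * noise_pow w)" for w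
  have intU: "integrable M U" unfolding U_def using intW orth(1) noise(1) by auto
  have "(\<integral>w. E w \<partial>M) \<le> (\<integral>w. U w \<partial>M)"
  proof (rule integral_mono[OF intE intU])
    fix w
    show "E w \<le> U w"
      using mult_left_mono[OF exp_clipped_noise_le[OF p_range \<Lambda>(1) e D l a vD, of w "answer w" w] W0[of w]]
      by (simp add: E_def U_def \<theta>_def k_def algebra_simps)
  qed
  also have "\<dots> = (\<integral>w. W w \<partial>M) + k * (\<integral>w. W w * noise_pow w \<partial>M)"
    unfolding U_def using intW orth noise(1) by simp
  also have "\<dots> \<le> (\<integral>w. W w \<partial>M) + k * (noise_bound * (\<integral>w. W w \<partial>M))"
    using k noise(2) by (intro add_left_mono mult_left_mono) auto
  finally show "(\<integral>w. E w \<partial>M) \<le> (1 + l / D\<^sup>2 * a * (2 * D * \<Lambda> powr (1 - p) + 9 / 2 * l * a * \<Lambda> powr (2 - p)) * noise_bound)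
        * (\<integral>w. W w \<partial>M)"
    by (simp add: k_def algebra_simps)
qed

end

section \<open>One phase\<close>

text \<open>
  The centre of the ball is random. By translation the projection is a measurable function of the
  centre and the point.
\<close>

lemma closest_point_cball:
  fixes c x :: "'a::euclidean_space"
  assumes "0 \<le> r"
  shows "closest_point (cball c r) x = c + closest_point (cball 0 r) (x - c)"
proof (rule closest_point_unique[symmetric])
  have in0: "closest_point (cball 0 r) (x - c) \<in> cball 0 r"
    using assms by (intro closest_point_in_set) auto
  then show "c + closest_point (cball 0 r) (x - c) \<in> cball c r" by (simp add: dist_norm)
  show "\<forall>z\<in>cball c r. dist x (c + closest_point (cball 0 r) (x - c)) \<le> dist x z"
  proof
    fix z assume "z \<in> cball c r"
    then have "z - c \<in> cball 0 r" by (simp add: dist_norm norm_minus_commute)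
    then have "dist (x - c) (closest_point (cball 0 r) (x - c)) \<le> dist (x - c) (z - c)"
      by (intro closest_point_le) auto
    then show "dist x (c + closest_point (cball 0 r) (x - c)) \<le> dist x z"
      by (simp add: dist_norm algebra_simps)
  qed
qed auto

lemma borel_measurable_closest_point_cball:
  fixes c h :: "'b \<Rightarrow> 'a::euclidean_space"
  assumes "0 \<le> r" and [measurable]: "c \<in> borel_measurable N" "h \<in> borel_measurable N"
  shows "(\<lambda>w. closest_point (cball (c w) r) (h w)) \<in> borel_measurable N"
proof -
  have [measurable]: "closest_point (cball (0::'a) r) \<in> borel_measurable borel"
    using assms(1) by (intro borel_measurable_continuous_onI continuous_on_closest_point) auto
  have "(\<lambda>w. closest_point (cball (c w) r) (h w)) = (\<lambda>w. c w + closest_point (cball 0 r) (h w - c w))"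
    by (rule ext) (rule closest_point_cball[OF assms(1)])
  also have "\<dots> \<in> borel_measurable N" by measurable
  finally show ?thesis .
qed

lemma ln_8_ge_2: "2 \<le> ln (8::real)"
proof -
  have "ln (8::real) = 3 * ln 2"
    using ln_realpow[of 2 3] by simp
  then show ?thesis using ln2_ge_two_thirds by simp
qed

text \<open>
  A phase that starts after \<open>n0\<close> global iterations at the random point \<open>w0\<close>; \<open>r\<close> is the radius and
  \<open>D = 2 * r\<close> the diameter of the ball. The condition on \<open>r\<close> is what makes the ball contain the
  minimizer.
\<close>

locale phase = oracle_objective f \<mu> H0 H1 xs p \<sigma>0 \<sigma>1 \<sigma>2 M \<Xi> \<xi> g
  for f :: "'a::euclidean_space \<Rightarrow> real" and \<mu> H0 H1 :: real and xs and p \<sigma>0 \<sigma>1 \<sigma>2 :: real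
    and M :: "'w measure" and \<Xi> :: "'b measure" and \<xi> and g +
  fixes \<Delta> \<rho> r :: real and n0 :: nat and w0 :: "'w \<Rightarrow> 'a"
  assumes \<Delta>: "0 < \<Delta>" and \<rho>: "0 < \<rho>" "\<rho> < 1" and r: "0 < r" "\<mu> * r\<^sup>2 = 2 * \<Delta>"
    and start: "w0 \<in> borel_measurable (sample_filtration M \<Xi> \<xi> n0)"
begin

definition D :: real where "D = 2 * r"
abbreviation T where "T \<equiv> phase_length p H0 H1 \<sigma>0 \<sigma>1 \<sigma>2 \<Delta> D \<rho>"
abbreviation a where "a \<equiv> step_weight p H0 H1 \<sigma>0 \<sigma>1 \<sigma>2 \<Delta> D \<rho>"
abbreviation A where "A \<equiv> total_weight p H0 H1 \<sigma>0 \<sigma>1 \<sigma>2 \<Delta> D \<rho>"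
abbreviation \<Lambda> where "\<Lambda> \<equiv> clip_level p H0 H1 \<sigma>0 \<sigma>1 \<sigma>2 \<Delta> D"
abbreviation G where "G \<equiv> grad_level H0 H1 \<Delta>"
abbreviation m where "m \<equiv> noise_level_pow p H0 H1 \<sigma>0 \<sigma>1 \<sigma>2 \<Delta>"
abbreviation l where "l \<equiv> ln (8 / \<rho>)"
abbreviation \<eta> where "\<eta> \<equiv> 5 * D / real T"

subsection \<open>The parameters\<close>

lemma D_pos: "0 < D"
  using r by (simp add: D_def)

lemma l_ge_2: "2 \<le> l"
proof -
  have "ln 8 \<le> l" using \<rho> by (intro ln_mono) (auto simp: field_simps)
  with ln_8_ge_2 show ?thesis by simp
qed

lemma \<Lambda>_ge: "2 * G \<le> \<Lambda>"
  by (simp add: clip_level_def)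

lemma \<Lambda>_pos: "0 < \<Lambda>"
  using \<Lambda>_ge grad_level_pos[OF \<Delta>] by simp

lemma m_nonneg: "0 \<le> m"
  by (simp add: noise_level_pow_def)

text \<open>
  This is what the second argument of the maximum in \<^const>\<open>clip_level\<close> is for: the bias of the
  clipped sample, paired with a vector of length \<open>D\<close>, is a small fraction of \<open>\<Delta>\<close>.
\<close>

lemma noise_le: "m * \<Lambda> powr (1 - p) \<le> \<Delta> / (64 * D)"
proof -
  have p: "0 < p - 1" using p_range by simp
  have nn: "0 \<le> 64 * m * D / \<Delta>" using m_nonneg D_pos \<Delta> by simp
  have "64 * m * D / \<Delta> = ((64 * m * D / \<Delta>) powr (1 / (p - 1))) powr (p - 1)"
    unfolding powr_powr using p powr_one[OF nn] by simp
  also have "\<dots> \<le> \<Lambda> powr (p - 1)"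
    using p by (intro powr_mono2) (auto simp: clip_level_def)
  finally have "64 * m * D / \<Delta> * \<Lambda> powr (1 - p) \<le> \<Lambda> powr (p - 1) * \<Lambda> powr (1 - p)"
    by (intro mult_right_mono) auto
  also have "\<dots> = 1" using \<Lambda>_pos by (simp flip: powr_add)
  finally show ?thesis using D_pos \<Delta> by (simp add: field_simps)
qed

lemma T_ge: "1024 * (1 + D * \<Lambda> / \<Delta>) * l \<le> real T"
  unfolding phase_length_def by linarith

lemma T_pos: "0 < real T"
proof -
  have "0 < 1024 * (1 + D * \<Lambda> / \<Delta>) * l"
    using D_pos \<Lambda>_pos \<Delta> l_ge_2 by (intro mult_pos_pos add_pos_pos) auto
  with T_ge show ?thesis by linarith
qed

lemma \<eta>_pos: "0 < \<eta>"
  using D_pos T_pos by simp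

lemma a_eq: "a = \<eta> * D / \<Delta>"
  by (simp add: step_weight_def power2_eq_square mult_ac)

lemma a_pos: "0 < a"
  unfolding a_eq by (intro divide_pos_pos mult_pos_pos \<eta>_pos D_pos \<Delta>)

text \<open>
  The linear dependence of the phase length on \<open>D * \<Lambda> / \<Delta>\<close> makes a single clipped step short against
  \<open>D / l\<close>.
\<close>

lemma a_small: "200 * l * a * \<Lambda> \<le> D"
proof -
  have "1000 * (D * \<Lambda> / \<Delta>) * l \<le> 1024 * (1 + D * \<Lambda> / \<Delta>) * l"
    using D_pos \<Lambda>_pos \<Delta> l_ge_2
    by (intro mult_right_mono mult_mono) (auto intro: divide_nonneg_nonneg)
  also have "\<dots> \<le> real T" by (rule T_ge)
  finally have "D * (1000 * (D * \<Lambda> / \<Delta>) * l) \<le> D * real T"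
    using D_pos by (intro mult_left_mono) auto
  moreover have "200 * l * a * \<Lambda> = D * (1000 * (D * \<Lambda> / \<Delta>) * l) / real T"
    by (simp add: a_eq mult_ac)
  ultimately show ?thesis using T_pos by (simp only: pos_divide_le_eq)
qed

lemma \<eta>_small: "2 * G * \<eta> \<le> \<Delta>"
proof -
  have "2 * G * a \<le> \<Lambda> * a" using \<Lambda>_ge a_pos by (intro mult_right_mono) auto
  also have "\<dots> = 1 * (a * \<Lambda>)" by simp
  also have "\<dots> \<le> 200 * l * (a * \<Lambda>)" using a_pos \<Lambda>_pos l_ge_2 by (intro mult_right_mono) auto
  also have "\<dots> \<le> D" using a_small by (simp add: mult.assoc)
  finally have "2 * G * \<eta> / \<Delta> * D \<le> 1 * D"
    unfolding a_eq by (simp add: mult_ac)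
  then have "2 * G * \<eta> / \<Delta> \<le> 1" using D_pos by (simp only: mult_le_cancel_right_pos)
  then show ?thesis using \<Delta> by (simp only: divide_le_eq_1_pos)
qed

lemma A_0: "A 0 = D\<^sup>2 / \<Delta>"
  by (simp add: total_weight_def)

lemma A_Suc: "A (Suc t) = A t + a"
  by (simp add: total_weight_def algebra_simps)

lemma A_ge: "D\<^sup>2 / \<Delta> \<le> A t"
  using a_pos by (simp add: total_weight_def)

lemma A_pos: "0 < A t"
proof -
  have "0 < D\<^sup>2 / \<Delta>" using D_pos \<Delta> by simp
  then show ?thesis using A_ge by (rule less_le_trans)
qed

lemma A_T: "A T = 6 * D\<^sup>2 / \<Delta>"
  using T_pos by (simp add: total_weight_def step_weight_def)

text \<open>
  The relative increase of the exponential potential in one iteration, as it comes out of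
  \<open>exponential_step\<close>. By \<open>growth_le\<close> it accumulates over the phase to at most \<open>exp (l / 6)\<close>.
\<close>

definition growth :: real where
  "growth = l / D\<^sup>2 * a * (2 * D * \<Lambda> powr (1 - p) + 9 / 2 * l * a * \<Lambda> powr (2 - p)) * m"

lemma growth_le: "real T * growth \<le> l / 6"
proof -
  have pw: "\<Lambda> powr (2 - p) = \<Lambda> * \<Lambda> powr (1 - p)"
    using \<Lambda>_pos powr_add[of \<Lambda> 1 "1 - p"] by simp
  have "(2 * D * \<Lambda> powr (1 - p) + 9 / 2 * l * a * \<Lambda> powr (2 - p)) * m
      = (2 * D + 9 / 2 * (l * a * \<Lambda>)) * (m * \<Lambda> powr (1 - p))"
    unfolding pw by (simp add: algebra_simps)
  also have "\<dots> \<le> (2 * D + 9 / 2 * (D / 200)) * (\<Delta> / (64 * D))"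
  proof (rule mult_mono)
    have "l * a * \<Lambda> \<le> D / 200" using a_small by simp
    then show "2 * D + 9 / 2 * (l * a * \<Lambda>) \<le> 2 * D + 9 / 2 * (D / 200)" by linarith
  qed (use noise_le D_pos m_nonneg in auto)
  also have "\<dots> \<le> \<Delta> / 30" using D_pos \<Delta> by (simp add: field_simps)
  finally have "real T * (l / D\<^sup>2 * a) * ((2 * D * \<Lambda> powr (1 - p) + 9 / 2 * l * a * \<Lambda> powr (2 - p)) * m)
      \<le> real T * (l / D\<^sup>2 * a) * (\<Delta> / 30)"
    using l_ge_2 a_pos by (intro mult_left_mono) auto
  also have "\<dots> = l / 6"
    unfolding a_eq using T_pos D_pos \<Delta> by (simp add: power2_eq_square)
  finally show ?thesis unfolding growth_def by (simp only: mult.assoc)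
qed

lemma growth_nonneg: "0 \<le> growth"
  using l_ge_2 a_pos D_pos m_nonneg by (simp add: growth_def)

subsection \<open>The iterates\<close>

definition state :: "nat \<Rightarrow> 'w \<Rightarrow> 'a \<times> 'a" where
  "state t \<omega> = phase_state p H0 H1 \<sigma>0 \<sigma>1 \<sigma>2 (\<lambda>t u. g u (\<xi> (n0 + t) \<omega>)) (w0 \<omega>) \<Delta> (cball (w0 \<omega>) r) D \<rho> t"

definition y :: "nat \<Rightarrow> 'w \<Rightarrow> 'a" where "y t \<omega> = fst (state t \<omega>)"
definition z :: "nat \<Rightarrow> 'w \<Rightarrow> 'a" where "z t \<omega> = snd (state t \<omega>)"
definition u :: "nat \<Rightarrow> 'w \<Rightarrow> 'a" where "u t \<omega> = (A t *\<^sub>R y t \<omega> + a *\<^sub>R z t \<omega>) /\<^sub>R A (Suc t)"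

abbreviation estimate :: "nat \<Rightarrow> 'w \<Rightarrow> 'a" where
  "estimate t \<omega> \<equiv> clip \<Lambda> (g (u t \<omega>) (\<xi> (Suc (n0 + t)) \<omega>))"

lemma y_0: "y 0 \<omega> = w0 \<omega>" and z_0: "z 0 \<omega> = w0 \<omega>"
  by (simp_all add: y_def z_def state_def)

lemma z_Suc: "z (Suc t) \<omega> = closest_point (cball (w0 \<omega>) r) (z t \<omega> - a *\<^sub>R estimate t \<omega>)"
  by (simp add: y_def z_def u_def state_def Let_def split_beta)

lemma y_Suc: "y (Suc t) \<omega> = (A t *\<^sub>R y t \<omega> + a *\<^sub>R z (Suc t) \<omega>) /\<^sub>R A (Suc t)"
  unfolding z_Suc by (simp add: y_def z_def u_def state_def Let_def split_beta)

lemma phase_output: "rcsag_phase p H0 H1 \<sigma>0 \<sigma>1 \<sigma>2 (\<lambda>t u. g u (\<xi> (n0 + t) \<omega>)) (w0 \<omega>) \<Delta> (cball (w0 \<omega>) r) D \<rho>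
    = y T \<omega>"
  by (simp add: rcsag_phase_def y_def state_def)

lemma u_measurable_if:
  assumes [measurable]: "y t \<in> borel_measurable N" "z t \<in> borel_measurable N"
  shows "u t \<in> borel_measurable N"
  unfolding u_def by measurable

lemma state_measurable:
  "y t \<in> borel_measurable (Fil (n0 + t)) \<and> z t \<in> borel_measurable (Fil (n0 + t))"
proof (induction t)
  case 0
  then show ?case using start by (simp add: y_0[abs_def] z_0[abs_def])
next
  case (Suc t)
  let ?N = "Fil (n0 + Suc t)"
  have le: "n0 + t \<le> n0 + Suc t" by simp
  have yt: "y t \<in> borel_measurable ?N" and zt: "z t \<in> borel_measurable ?N"
    by (rule measurable_Fil_mono[OF le conjunct1[OF Suc]], rule measurable_Fil_mono[OF le conjunct2[OF Suc]])
  have w0: "w0 \<in> borel_measurable ?N"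
    by (rule measurable_Fil_mono[OF _ start]) simp
  have "\<xi> (Suc (n0 + t)) \<in> measurable ?N \<Xi>"
    using sample_measurable_Fil[of "Suc (n0 + t)"] by simp
  then have pair: "(\<lambda>\<omega>. (u t \<omega>, \<xi> (Suc (n0 + t)) \<omega>)) \<in> measurable ?N (borel \<Otimes>\<^sub>M \<Xi>)"
    by (intro measurable_Pair u_measurable_if yt zt)
  have "(\<lambda>\<omega>. g (u t \<omega>) (\<xi> (Suc (n0 + t)) \<omega>)) \<in> borel_measurable ?N"
    using measurable_compose[OF pair oracle_measurable] by simp
  then have "estimate t \<in> borel_measurable ?N"
    by (rule measurable_compose[OF _ borel_measurable_clip])
  then have z: "z (Suc t) \<in> borel_measurable ?N"
    unfolding z_Suc[abs_def] using r
    by (intro borel_measurable_closest_point_cball w0 borel_measurable_diff borel_measurable_scaleR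
        borel_measurable_const zt) simp_all
  then have "y (Suc t) \<in> borel_measurable ?N"
    unfolding y_Suc[abs_def]
    by (intro borel_measurable_scaleR borel_measurable_add borel_measurable_const yt)
  then show ?case using z by (rule conjI)
qed

lemma iterates_measurable:
  assumes "t \<le> t'"
  shows "y t \<in> borel_measurable (Fil (n0 + t'))" "z t \<in> borel_measurable (Fil (n0 + t'))"
proof -
  have le: "n0 + t \<le> n0 + t'" using assms by simp
  show "y t \<in> borel_measurable (Fil (n0 + t'))"
    by (rule measurable_Fil_mono[OF le conjunct1[OF state_measurable]])
  show "z t \<in> borel_measurable (Fil (n0 + t'))"
    by (rule measurable_Fil_mono[OF le conjunct2[OF state_measurable]])
qed

lemma start_measurable: "w0 \<in> borel_measurable (Fil (n0 + t))"
  by (rule measurable_Fil_mono[OF _ start]) simp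

lemma z_in_ball: "z t \<omega> \<in> cball (w0 \<omega>) r"
proof (cases t)
  case 0
  then show ?thesis using r by (simp add: z_0)
next
  case (Suc t')
  then show ?thesis unfolding Suc z_Suc using r by (intro closest_point_in_set) auto
qed

lemma y_in_ball: "y t \<omega> \<in> cball (w0 \<omega>) r"
proof (induction t)
  case 0
  then show ?case using r by (simp add: y_0)
next
  case (Suc t)
  have eq: "y (Suc t) \<omega> = (A t / A (Suc t)) *\<^sub>R y t \<omega> + (a / A (Suc t)) *\<^sub>R z (Suc t) \<omega>"
    by (simp add: y_Suc scaleR_add_right divide_inverse mult.commute)
  have "A t / A (Suc t) + a / A (Suc t) = 1"
    using A_pos[of "Suc t"] by (simp add: A_Suc flip: add_divide_distrib)
  then show ?case unfolding eq using A_pos[of t] A_pos[of "Suc t"] a_pos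
    by (intro convexD[OF convex_cball Suc z_in_ball]) auto
qed

lemma dist_in_ball:
  assumes "b \<in> cball c r" "d \<in> cball c r"
  shows "norm (b - d) \<le> D"
proof -
  have "dist b d \<le> dist b c + dist c d" by (rule dist_triangle)
  then show ?thesis using assms by (simp add: dist_commute dist_norm D_def)
qed

lemma minimizer_in_ball:
  assumes "F (w0 \<omega>) \<le> \<Delta>"
  shows "xs \<in> cball (w0 \<omega>) r"
proof -
  have "\<mu> * (norm (w0 \<omega> - xs))\<^sup>2 \<le> \<mu> * r\<^sup>2"
    using norm_le_excess[of "w0 \<omega>"] assms r by simp
  then have "(norm (w0 \<omega> - xs))\<^sup>2 \<le> r\<^sup>2" using mu_pos by simp
  then have "norm (w0 \<omega> - xs) \<le> r" by (rule power2_le_imp_le) (use r in simp)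
  then show ?thesis by (simp add: dist_norm)
qed

subsection \<open>The potential\<close>

definition good :: "nat \<Rightarrow> 'w \<Rightarrow> bool" where
  "good t \<omega> \<longleftrightarrow> F (w0 \<omega>) \<le> \<Delta> \<and> (\<forall>j\<in>{..t}. A j * F (y j \<omega>) \<le> 3 * D\<^sup>2)"

definition potential :: "nat \<Rightarrow> 'w \<Rightarrow> real" where
  "potential t \<omega> = A t * F (y t \<omega>) + 1 / 2 * (norm (z t \<omega> - xs))\<^sup>2"

lemma good_Suc: "good (Suc t) \<omega> \<longleftrightarrow> good t \<omega> \<and> A (Suc t) * F (y (Suc t) \<omega>) \<le> 3 * D\<^sup>2"
  by (auto simp: good_def le_Suc_eq)

text \<open>
  The value of \<open>F\<close> at \<open>z\<close> is not controlled, so convexity is of no use here; instead the query is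
  close to \<open>y\<close>.
\<close>

lemma query_level:
  assumes "good t \<omega>"
  shows "F (u t \<omega>) \<le> 4 * \<Delta>"
proof (rule query_excess_le[OF \<Delta> \<eta>_small])
  have "D\<^sup>2 / \<Delta> * F (y t \<omega>) \<le> A t * F (y t \<omega>)"
    using A_ge excess_nonneg by (intro mult_right_mono)
  also have "\<dots> \<le> 3 * D\<^sup>2" using assms by (simp add: good_def)
  finally have "D\<^sup>2 * F (y t \<omega>) \<le> D\<^sup>2 * (3 * \<Delta>)" using \<Delta> by (simp add: field_simps)
  then show "F (y t \<omega>) \<le> 3 * \<Delta>" using D_pos by (simp only: mult_le_cancel_left_pos zero_less_power)
  have A': "0 < A (Suc t)" by (rule A_pos)
  have "A (Suc t) *\<^sub>R (u t \<omega> - y t \<omega>) = a *\<^sub>R (z t \<omega> - y t \<omega>)"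
    using A' by (simp add: u_def scaleR_diff_right) (simp add: A_Suc scaleR_add_left)
  then have "norm (A (Suc t) *\<^sub>R (u t \<omega> - y t \<omega>)) = a * norm (z t \<omega> - y t \<omega>)"
    using a_pos by simp
  then have "A (Suc t) * norm (u t \<omega> - y t \<omega>) = a * norm (z t \<omega> - y t \<omega>)"
    using A' by simp
  also have "\<dots> \<le> a * D"
    using a_pos dist_in_ball[OF z_in_ball y_in_ball] by (intro mult_left_mono) auto
  also have "\<dots> = D\<^sup>2 / \<Delta> * \<eta>" by (simp add: a_eq power2_eq_square mult_ac)
  also have "\<dots> \<le> A (Suc t) * \<eta>" using A_ge \<eta>_pos by (intro mult_right_mono) auto
  finally show "norm (u t \<omega> - y t \<omega>) \<le> \<eta>" using A' by (simp only: mult_le_cancel_left_pos)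
qed

lemma potential_step:
  assumes "good t \<omega>"
  defines "\<theta> \<equiv> grad (u t \<omega>) - estimate t \<omega>"
  shows "potential (Suc t) \<omega> \<le> potential t \<omega> + (a * (\<theta> \<bullet> (z t \<omega> - xs)) + a\<^sup>2 * (norm \<theta>)\<^sup>2)"
  unfolding potential_def \<theta>_def
proof (rule similar_triangles_step[OF \<Delta> D_pos \<eta>_pos \<eta>_small convex_cball closed_cball _ less_imp_le[OF A_pos] A_Suc A_ge a_eq _ _ query_level z_Suc])
  show "xs \<in> cball (w0 \<omega>) r" using assms by (intro minimizer_in_ball) (simp add: good_def)
  show "A (Suc t) *\<^sub>R u t \<omega> = A t *\<^sub>R y t \<omega> + a *\<^sub>R z t \<omega>"
    using A_pos[of "Suc t"] by (simp add: u_def)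
  show "A (Suc t) *\<^sub>R y (Suc t) \<omega> = A t *\<^sub>R y t \<omega> + a *\<^sub>R z (Suc t) \<omega>"
    using A_pos[of "Suc t"] by (simp add: y_Suc)
  show "norm (z (Suc t) \<omega> - z t \<omega>) \<le> D" by (intro dist_in_ball[OF z_in_ball z_in_ball])
qed (rule assms)

lemma potential_0:
  assumes "F (w0 \<omega>) \<le> \<Delta>"
  shows "potential 0 \<omega> \<le> 3 / 2 * D\<^sup>2" and "good 0 \<omega>"
proof -
  have AF: "A 0 * F (y 0 \<omega>) \<le> D\<^sup>2"
  proof -
    have "A 0 * F (y 0 \<omega>) \<le> A 0 * \<Delta>" using assms A_pos by (simp add: y_0)
    also have "\<dots> = D\<^sup>2" using \<Delta> by (simp add: A_0)
    finally show ?thesis .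
  qed
  moreover have "(norm (z 0 \<omega> - xs))\<^sup>2 \<le> D\<^sup>2"
    by (intro power_mono dist_in_ball[OF z_in_ball minimizer_in_ball] assms) auto
  ultimately show "potential 0 \<omega> \<le> 3 / 2 * D\<^sup>2" by (simp add: potential_def)
  have "A 0 * F (y 0 \<omega>) \<le> 3 * D\<^sup>2" using AF zero_le_power2[of D] by linarith
  then show "good 0 \<omega>" using assms by (simp add: good_def)
qed

lemma potential_le:
  assumes "good t \<omega>"
  shows "potential t \<omega> \<le> 4 * D\<^sup>2"
proof -
  have "(norm (z t \<omega> - xs))\<^sup>2 \<le> D\<^sup>2"
    using assms by (intro power_mono dist_in_ball[OF z_in_ball minimizer_in_ball]) (auto simp: good_def)
  moreover have "A t * F (y t \<omega>) \<le> 3 * D\<^sup>2" using assms by (simp add: good_def)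
  moreover have "0 \<le> D\<^sup>2" by simp
  ultimately show ?thesis unfolding potential_def by linarith
qed

lemma pred_good: "Measurable.pred (Fil (n0 + t)) (good t)"
proof -
  have "Measurable.pred (Fil (n0 + t)) (\<lambda>\<omega>. A j * F (y j \<omega>) \<le> 3 * D\<^sup>2)" if "j \<in> {..t}" for j
  proof -
    have [measurable]: "y j \<in> borel_measurable (Fil (n0 + t))"
      using that by (intro iterates_measurable) auto
    show ?thesis by measurable
  qed
  then have "Measurable.pred (Fil (n0 + t)) (\<lambda>\<omega>. \<forall>j\<in>{..t}. A j * F (y j \<omega>) \<le> 3 * D\<^sup>2)"
    by (rule pred_intros_finite(3)[OF finite_atMost])
  moreover have "Measurable.pred (Fil (n0 + t)) (\<lambda>\<omega>. F (w0 \<omega>) \<le> \<Delta>)"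
  proof -
    note [measurable] = start_measurable[of t]
    show ?thesis by measurable
  qed
  ultimately show ?thesis unfolding good_def by (intro pred_intros_logic)
qed

lemma potential_measurable: "potential t \<in> borel_measurable (Fil (n0 + t))"
proof -
  note [measurable] = iterates_measurable[OF order_refl[of t]]
  show ?thesis unfolding potential_def by measurable
qed

subsection \<open>The failure probability\<close>

text \<open>
  The exponential of the potential is stopped when \<open>good\<close> fails for the first time. At that moment
  the potential exceeds \<open>3 * D\<^sup>2\<close>, so replacing the exponential by the constant \<open>exp (3 * l)\<close> is no
  increase; and \<open>weight t\<close>, the part that still runs, is bounded.
\<close>

definition weight :: "nat \<Rightarrow> 'w \<Rightarrow> real" where
  "weight t \<omega> = (if good t \<omega> then exp (l / D\<^sup>2 * potential t \<omega>) else 0)"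

definition stopped :: "nat \<Rightarrow> 'w \<Rightarrow> real" where
  "stopped t \<omega> = (if F (w0 \<omega>) \<le> \<Delta> \<and> \<not> good t \<omega> then exp (3 * l) else 0)"

lemma scaled_exp_le:
  assumes "potential t \<omega> \<le> c * D\<^sup>2"
  shows "exp (l / D\<^sup>2 * potential t \<omega>) \<le> exp (c * l)"
proof -
  have "l / D\<^sup>2 * potential t \<omega> \<le> l / D\<^sup>2 * (c * D\<^sup>2)"
    using assms l_ge_2 by (intro mult_left_mono) auto
  then show ?thesis using D_pos by (simp add: mult.commute)
qed

lemma weight_nonneg: "0 \<le> weight t \<omega>"
  by (simp add: weight_def)

lemma weight_le: "weight t \<omega> \<le> exp (4 * l)"
  using scaled_exp_le[OF potential_le] by (simp add: weight_def)

lemma weight_measurable: "weight t \<in> borel_measurable (Fil (n0 + t))"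
proof -
  note [measurable] = pred_good[of t] potential_measurable[of t]
  show ?thesis unfolding weight_def by measurable
qed

lemma stopped_measurable: "stopped t \<in> borel_measurable (Fil (n0 + t))"
proof -
  note [measurable] = pred_good[of t] start_measurable[of t]
  show ?thesis unfolding stopped_def by measurable
qed

lemma integrable_weight: "integrable M (weight t)"
  using weight_nonneg weight_le measurable_Fil_imp[OF weight_measurable[of t]]
  by (intro integrable_const_bound[of _ "exp (4 * l)"]) auto

lemma integrable_stopped: "integrable M (stopped t)"
  using measurable_Fil_imp[OF stopped_measurable[of t]]
  by (intro integrable_const_bound[of _ "exp (3 * l)"]) (auto simp: stopped_def)

text \<open>
  Outside \<open>good t\<close> the weight vanishes, so there the query may be replaced by the minimizer and the direction
  by \<open>0\<close>; the replacements satisfy the bounds of \<open>exponential_step\<close> everywhere.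
\<close>

lemma stopped_step:
  "(\<integral>\<omega>. weight (Suc t) \<omega> + stopped (Suc t) \<omega> \<partial>M) \<le> (1 + growth) * (\<integral>\<omega>. weight t \<omega> + stopped t \<omega> \<partial>M)"
proof -
  define x where "x \<omega> = (if good t \<omega> then u t \<omega> else xs)" for \<omega>
  define v where "v \<omega> = (if good t \<omega> then z t \<omega> - xs else 0)" for \<omega>
  note [measurable] = pred_good[of t] iterates_measurable[OF order_refl[of t]] weight_measurable[of t]
  have [measurable]: "u t \<in> borel_measurable (Fil (n0 + t))"
    by (rule u_measurable_if) measurable
  interpret bounded_query f \<mu> H0 H1 xs p \<sigma>0 \<sigma>1 \<sigma>2 M \<Xi> \<xi> g \<Delta> "Suc (n0 + t)" x
  proof unfold_locales
    show "x \<in> borel_measurable (Fil (Suc (n0 + t) - 1))" unfolding x_def by simp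
    show "F (x \<omega>) \<le> 4 * \<Delta>" for \<omega> using query_level[of t \<omega>] \<Delta> by (auto simp: x_def)
  qed (use \<Delta> in auto)
  have v: "v \<in> borel_measurable (Fil (Suc (n0 + t) - 1))" unfolding v_def by simp
  have vD: "norm (v \<omega>) \<le> D" for \<omega>
    using dist_in_ball[OF z_in_ball minimizer_in_ball, of \<omega> t] D_pos by (auto simp: v_def good_def)
  have W: "weight t \<in> borel_measurable (Fil (Suc (n0 + t) - 1))" by simp
  have l: "1 \<le> l" using l_ge_2 by simp
  define E where "E \<omega> = weight t \<omega> * exp (l / D\<^sup>2 * (a * ((grad (x \<omega>) - clip \<Lambda> (answer \<omega>)) \<bullet> v \<omega>)
      + a\<^sup>2 * (norm (grad (x \<omega>) - clip \<Lambda> (answer \<omega>)))\<^sup>2))" for \<omega>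
  note step = exponential_step[OF \<Lambda>_pos \<Lambda>_ge D_pos l less_imp_le[OF a_pos] a_small v vD W weight_nonneg weight_le,
      folded E_def growth_def]
  have le: "weight (Suc t) \<omega> + stopped (Suc t) \<omega> \<le> E \<omega> + stopped t \<omega>" for \<omega>
  proof (cases "good t \<omega>")
    case True
    define X where "X = a * ((grad (u t \<omega>) - estimate t \<omega>) \<bullet> (z t \<omega> - xs))
        + a\<^sup>2 * (norm (grad (u t \<omega>) - estimate t \<omega>))\<^sup>2"
    have "exp (l / D\<^sup>2 * potential (Suc t) \<omega>) \<le> exp (l / D\<^sup>2 * (potential t \<omega> + X))"
      using potential_step[OF True] l_ge_2 by (auto simp: X_def intro!: divide_right_mono mult_left_mono)
    also have "\<dots> = E \<omega>"
      using True by (simp add: E_def weight_def x_def v_def X_def distrib_left exp_add)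
    finally have 1: "exp (l / D\<^sup>2 * potential (Suc t) \<omega>) \<le> E \<omega>" .
    have 2: "exp (3 * l) \<le> exp (l / D\<^sup>2 * potential (Suc t) \<omega>)" if "\<not> good (Suc t) \<omega>"
    proof -
      have "3 * D\<^sup>2 \<le> A (Suc t) * F (y (Suc t) \<omega>)" using that True by (simp add: good_Suc)
      also have "\<dots> \<le> potential (Suc t) \<omega>" by (simp add: potential_def)
      finally have "l / D\<^sup>2 * (3 * D\<^sup>2) \<le> l / D\<^sup>2 * potential (Suc t) \<omega>"
        using l_ge_2 by (intro mult_left_mono) auto
      then show ?thesis using D_pos by simp
    qed
    show ?thesis
    proof (cases "good (Suc t) \<omega>")
      case True
      then show ?thesis using 1 \<open>good t \<omega>\<close> by (simp add: weight_def stopped_def)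
    next
      case False
      have "F (w0 \<omega>) \<le> \<Delta>" using \<open>good t \<omega>\<close> by (simp add: good_def)
      then show ?thesis using order_trans[OF 2[OF False] 1] False \<open>good t \<omega>\<close>
        by (simp add: weight_def stopped_def)
    qed
  next
    case False
    then show ?thesis by (simp add: weight_def stopped_def good_Suc E_def)
  qed
  have "(\<integral>\<omega>. weight (Suc t) \<omega> + stopped (Suc t) \<omega> \<partial>M) \<le> (\<integral>\<omega>. E \<omega> + stopped t \<omega> \<partial>M)"
    using step(1) integrable_weight integrable_stopped le by (intro integral_mono) auto
  also have "\<dots> = (\<integral>\<omega>. E \<omega> \<partial>M) + (\<integral>\<omega>. stopped t \<omega> \<partial>M)"
    using step(1) integrable_stopped by simp
  also have "\<dots> \<le> (1 + growth) * (\<integral>\<omega>. weight t \<omega> \<partial>M) + (1 + growth) * (\<integral>\<omega>. stopped t \<omega> \<partial>M)"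
  proof (rule add_mono)
    have "0 \<le> (\<integral>\<omega>. stopped t \<omega> \<partial>M)" by (intro Bochner_Integration.integral_nonneg) (simp add: stopped_def)
    then show "(\<integral>\<omega>. stopped t \<omega> \<partial>M) \<le> (1 + growth) * (\<integral>\<omega>. stopped t \<omega> \<partial>M)"
      using growth_nonneg by (simp add: algebra_simps)
  qed (rule step(2))
  also have "\<dots> = (1 + growth) * (\<integral>\<omega>. weight t \<omega> + stopped t \<omega> \<partial>M)"
    using integrable_weight integrable_stopped by (simp add: distrib_left)
  finally show ?thesis .
qed

lemma stopped_bound:
  "(\<integral>\<omega>. weight t \<omega> + stopped t \<omega> \<partial>M) \<le> exp (real t * growth + 3 / 2 * l)"
proof (induction t)
  case 0
  have "weight 0 \<omega> + stopped 0 \<omega> \<le> exp (3 / 2 * l)" for \<omega>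
    using scaled_exp_le[OF potential_0(1)] potential_0(2)
    by (auto simp: weight_def stopped_def good_def)
  then have "(\<integral>\<omega>. weight 0 \<omega> + stopped 0 \<omega> \<partial>M) \<le> (\<integral>\<omega>. exp (3 / 2 * l) \<partial>M)"
    using integrable_weight integrable_stopped by (intro integral_mono) auto
  then show ?case by (simp add: prob_space)
next
  case (Suc t)
  have "(\<integral>\<omega>. weight (Suc t) \<omega> + stopped (Suc t) \<omega> \<partial>M) \<le> (1 + growth) * (\<integral>\<omega>. weight t \<omega> + stopped t \<omega> \<partial>M)"
    by (rule stopped_step)
  also have "\<dots> \<le> exp growth * exp (real t * growth + 3 / 2 * l)"
    using growth_nonneg Suc by (intro mult_mono exp_ge_add_one_self)
      (auto intro!: Bochner_Integration.integral_nonneg simp: weight_nonneg stopped_def)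
  also have "\<dots> = exp (real (Suc t) * growth + 3 / 2 * l)"
    by (simp add: algebra_simps flip: exp_add)
  finally show ?case .
qed

lemma output_measurable: "y T \<in> borel_measurable (Fil (n0 + T))"
  by (rule iterates_measurable) simp

text \<open>
  Since \<open>A T = 6 * D\<^sup>2 / \<Delta>\<close>, a failing phase is not \<open>good\<close> at its end, so the stopped exponential
  is \<open>exp (3 * l)\<close>. Its mean is at most \<open>exp (l / 6 + 3 / 2 * l)\<close>, which leaves a probability of at
  most \<open>exp (- l) = \<rho> / 8\<close>.
\<close>

theorem phase_failure:
  "prob {\<omega> \<in> space M. F (w0 \<omega>) \<le> \<Delta> \<and> \<Delta> / 2 < F (y T \<omega>)} \<le> \<rho>"
proof -
  define B where "B = {\<omega> \<in> space M. F (w0 \<omega>) \<le> \<Delta> \<and> \<Delta> / 2 < F (y T \<omega>)}"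
  have [measurable]: "y T \<in> borel_measurable M" "w0 \<in> borel_measurable M"
    using measurable_Fil_imp[OF output_measurable] measurable_Fil_imp[OF start] by auto
  have [measurable]: "B \<in> sets M" unfolding B_def by measurable
  have "exp (3 * l) * prob B = (\<integral>\<omega>. exp (3 * l) * indicator B \<omega> \<partial>M)" by simp
  also have "\<dots> \<le> (\<integral>\<omega>. weight T \<omega> + stopped T \<omega> \<partial>M)"
  proof (rule integral_mono)
    fix \<omega>
    show "exp (3 * l) * indicator B \<omega> \<le> weight T \<omega> + stopped T \<omega>"
    proof (cases "\<omega> \<in> B")
      case True
      then have "\<Delta> / 2 < F (y T \<omega>)" by (simp add: B_def)
      then have "A T * (\<Delta> / 2) < A T * F (y T \<omega>)" using A_pos by (simp add: mult_less_cancel_left_pos)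
      moreover have "A T * (\<Delta> / 2) = 3 * D\<^sup>2" using \<Delta> by (simp add: A_T)
      ultimately have "\<not> good T \<omega>" by (auto simp: good_def not_le intro!: bexI[of _ T])
      then show ?thesis using True by (simp add: B_def stopped_def weight_def)
    next
      case False
      then show ?thesis by (simp add: weight_nonneg stopped_def)
    qed
  next
    show "integrable M (\<lambda>\<omega>. exp (3 * l) * indicator B \<omega>)" by (simp add: emeasure_eq_measure)
    show "integrable M (\<lambda>\<omega>. weight T \<omega> + stopped T \<omega>)"
      using integrable_weight integrable_stopped by auto
  qed
  also have "\<dots> \<le> exp (real T * growth + 3 / 2 * l)" by (rule stopped_bound)
  also have "\<dots> \<le> exp (3 * l - l)" using growth_le l_ge_2 by simp
  also have "\<dots> = exp (3 * l) * exp (- l)" by (simp flip: exp_add)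
  finally have "prob B \<le> exp (- l)" by simp
  also have "\<dots> = \<rho> / 8" using \<rho> by (simp add: exp_minus)
  finally show ?thesis using \<rho> by (simp add: B_def)
qed

end

section \<open>Restarts\<close>

lemma calls_before_Suc:
  "calls_before p H0 H1 \<sigma>0 \<sigma>1 \<sigma>2 \<mu> \<Delta>0 \<rho> (Suc s) = calls_before p H0 H1 \<sigma>0 \<sigma>1 \<sigma>2 \<mu> \<Delta>0 \<rho> s
     + phase_length p H0 H1 \<sigma>0 \<sigma>1 \<sigma>2 (phase_target \<Delta>0 s) (2 * ball_radius \<mu> \<Delta>0 s) (phase_confidence \<rho> s)"
  by (simp add: calls_before_def)

lemma phase_confidence_bounds:
  assumes "0 < \<rho>" "\<rho> < 1"
  shows "0 < phase_confidence \<rho> s" "phase_confidence \<rho> s < 1"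
proof -
  show "0 < phase_confidence \<rho> s" using assms by (simp add: phase_confidence_def)
  have "3 * 3 < pi * pi" using pi_gt3 by (intro mult_strict_mono) auto
  then have pi: "6 < pi\<^sup>2" by (simp add: power2_eq_square)
  have "1 \<le> (real s + 1)\<^sup>2" by (rule one_le_power) simp
  then have "pi\<^sup>2 * 1 \<le> pi\<^sup>2 * (real s + 1)\<^sup>2" by (intro mult_left_mono) auto
  then have "6 * \<rho> < pi\<^sup>2 * (real s + 1)\<^sup>2" using pi assms by linarith
  then show "phase_confidence \<rho> s < 1" by (simp add: phase_confidence_def divide_less_eq)
qed

lemma sum_phase_confidence_le:
  assumes "0 \<le> \<rho>"
  shows "(\<Sum>s<n. phase_confidence \<rho> s) \<le> \<rho>"
proof -
  have "(\<Sum>s<n. 1 / (real s + 1)\<^sup>2) \<le> (\<Sum>s. 1 / (real s + 1)\<^sup>2)"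
    using inverse_squares_sums by (intro sum_le_suminf) (auto simp: sums_iff add.commute)
  also have "\<dots> = pi\<^sup>2 / 6" using inverse_squares_sums by (simp add: sums_iff add.commute)
  finally have "6 * \<rho> / pi\<^sup>2 * (\<Sum>s<n. 1 / (real s + 1)\<^sup>2) \<le> 6 * \<rho> / pi\<^sup>2 * (pi\<^sup>2 / 6)"
    using assms by (intro mult_left_mono) auto
  then show ?thesis by (simp add: phase_confidence_def sum_distrib_left)
qed

lemma phase_target_le:
  assumes "0 < \<epsilon>" "\<epsilon> \<le> \<Delta>0"
  shows "phase_target \<Delta>0 (num_phases \<Delta>0 \<epsilon>) \<le> \<epsilon>"
proof -
  have "log 2 (\<Delta>0 / \<epsilon>) \<le> real (num_phases \<Delta>0 \<epsilon>)"
    unfolding num_phases_def by linarith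
  then have "\<Delta>0 / \<epsilon> \<le> 2 powr real (num_phases \<Delta>0 \<epsilon>)"
    using assms by (simp add: log_le_iff)
  then have "\<Delta>0 / \<epsilon> \<le> 2 ^ num_phases \<Delta>0 \<epsilon>" by (simp add: powr_realpow)
  then show ?thesis using assms by (simp add: phase_target_def field_simps)
qed

text \<open>
  Phase \<open>s\<close> is followed by \<open>num_phases \<Delta>0 \<epsilon> - Suc s\<close> further ones; the target of the last phase
  is at least \<open>\<epsilon>\<close>.
\<close>

lemma phase_target_ge:
  assumes "0 < \<epsilon>" "\<epsilon> \<le> \<Delta>0" "s < num_phases \<Delta>0 \<epsilon>"
  shows "2 ^ (num_phases \<Delta>0 \<epsilon> - Suc s) * \<epsilon> \<le> phase_target \<Delta>0 s"
proof -
  define S where "S = num_phases \<Delta>0 \<epsilon>"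
  have "real (S - 1) \<le> log 2 (\<Delta>0 / \<epsilon>)"
    using assms(3) unfolding S_def num_phases_def by linarith
  then have "2 powr real (S - 1) \<le> \<Delta>0 / \<epsilon>"
    using assms by (simp add: le_log_iff)
  then have "2 ^ (S - 1) * \<epsilon> \<le> \<Delta>0" using assms by (simp add: powr_realpow field_simps)
  moreover have "(2::real) ^ (S - 1) = 2 ^ (S - Suc s) * 2 ^ s"
    using assms(3) by (simp add: S_def flip: power_add)
  ultimately show ?thesis by (simp add: phase_target_def S_def field_simps)
qed

context oracle_objective
begin

context
  fixes \<Delta>0 \<rho> :: real and x0 :: 'a
  assumes \<Delta>0: "0 < \<Delta>0" and \<rho>: "0 < \<rho>" "\<rho> < 1"
begin

definition iterate :: "nat \<Rightarrow> 'w \<Rightarrow> 'a" where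
  "iterate s \<omega> = rcsag_iterate p H0 H1 \<sigma>0 \<sigma>1 \<sigma>2 \<mu> \<Delta>0 \<rho> (\<lambda>n u. g u (\<xi> n \<omega>)) x0 s"

abbreviation calls where "calls \<equiv> calls_before p H0 H1 \<sigma>0 \<sigma>1 \<sigma>2 \<mu> \<Delta>0 \<rho>"

lemma phase_instance:
  assumes "iterate s \<in> borel_measurable (Fil (calls s))"
  shows "phase f \<mu> H0 H1 xs p \<sigma>0 \<sigma>1 \<sigma>2 M \<Xi> \<xi> g
    (phase_target \<Delta>0 s) (phase_confidence \<rho> s) (ball_radius \<mu> \<Delta>0 s) (calls s) (iterate s)"
proof unfold_locales
  show pos: "0 < phase_target \<Delta>0 s" using \<Delta>0 by (simp add: phase_target_def)
  show "0 < ball_radius \<mu> \<Delta>0 s" "\<mu> * (ball_radius \<mu> \<Delta>0 s)\<^sup>2 = 2 * phase_target \<Delta>0 s"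
    using pos mu_pos by (simp_all add: ball_radius_def)
qed (use phase_confidence_bounds[OF \<rho>] assms in auto)

lemma iterate_step:
  assumes "iterate s \<in> borel_measurable (Fil (calls s))"
  shows "iterate (Suc s) \<in> borel_measurable (Fil (calls (Suc s)))"
    and "prob {\<omega> \<in> space M. F (iterate s \<omega>) \<le> phase_target \<Delta>0 s \<and> phase_target \<Delta>0 (Suc s) < F (iterate (Suc s) \<omega>)}
      \<le> phase_confidence \<rho> s"
proof -
  interpret P: phase f \<mu> H0 H1 xs p \<sigma>0 \<sigma>1 \<sigma>2 M \<Xi> \<xi> g
    "phase_target \<Delta>0 s" "phase_confidence \<rho> s" "ball_radius \<mu> \<Delta>0 s" "calls s" "iterate s"
    by (rule phase_instance[OF assms])
  have step: "iterate (Suc s) = P.y P.T"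
  proof
    fix \<omega>
    have "iterate (Suc s) \<omega> = rcsag_phase p H0 H1 \<sigma>0 \<sigma>1 \<sigma>2 (\<lambda>t u. g u (\<xi> (calls s + t) \<omega>)) (iterate s \<omega>)
        (phase_target \<Delta>0 s) (cball (iterate s \<omega>) (ball_radius \<mu> \<Delta>0 s)) P.D (phase_confidence \<rho> s)"
      by (simp add: iterate_def P.D_def)
    also have "\<dots> = P.y P.T \<omega>" by (rule P.phase_output)
    finally show "iterate (Suc s) \<omega> = P.y P.T \<omega>" .
  qed
  have count: "calls (Suc s) = calls s + P.T"
    by (simp add: calls_before_Suc P.D_def)
  show "iterate (Suc s) \<in> borel_measurable (Fil (calls (Suc s)))"
    unfolding step count by (rule P.output_measurable)
  have "phase_target \<Delta>0 (Suc s) = phase_target \<Delta>0 s / 2" by (simp add: phase_target_def)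
  then show "prob {\<omega> \<in> space M. F (iterate s \<omega>) \<le> phase_target \<Delta>0 s \<and> phase_target \<Delta>0 (Suc s) < F (iterate (Suc s) \<omega>)}
      \<le> phase_confidence \<rho> s"
    using P.phase_failure by (simp only: step)
qed

lemma iterate_measurable: "iterate s \<in> borel_measurable (Fil (calls s))"
proof (induction s)
  case 0
  then show ?case by (simp add: iterate_def[abs_def])
next
  case (Suc s)
  then show ?case by (rule iterate_step)
qed

text \<open>
  Without a failing phase the targets are met one after the other. The failures of the phases
  add up by a union bound.
\<close>

lemma success_probability:
  assumes start: "F x0 \<le> \<Delta>0"
  shows "1 - \<rho> \<le> prob {\<omega> \<in> space M. F (iterate n \<omega>) \<le> phase_target \<Delta>0 n}"
proof -
  define bad where "bad s = {\<omega> \<in> space M. F (iterate s \<omega>) \<le> phase_target \<Delta>0 s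
      \<and> phase_target \<Delta>0 (Suc s) < F (iterate (Suc s) \<omega>)}" for s
  define success where "success = {\<omega> \<in> space M. F (iterate n \<omega>) \<le> phase_target \<Delta>0 n}"
  have [measurable]: "iterate s \<in> borel_measurable M" for s
    by (rule measurable_Fil_imp[OF iterate_measurable])
  have [measurable]: "bad s \<in> sets M" for s unfolding bad_def by measurable
  have [measurable]: "success \<in> sets M" unfolding success_def by measurable
  have reach: "F (iterate k \<omega>) \<le> phase_target \<Delta>0 k" if "\<omega> \<in> space M" "\<forall>s<n. \<omega> \<notin> bad s" "k \<le> n" for \<omega> k
    using that(3)
  proof (induction k)
    case 0
    then show ?case using start by (simp add: iterate_def phase_target_def)
  next
    case (Suc k)
    then have "F (iterate k \<omega>) \<le> phase_target \<Delta>0 k" "\<omega> \<notin> bad k" using that(2) by auto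
    then show ?case using that(1) by (simp add: bad_def not_less)
  qed
  have "space M - success \<subseteq> (\<Union>s\<in>{..<n}. bad s)"
    using reach[of _ n] by (auto simp: success_def)
  then have "prob (space M - success) \<le> prob (\<Union>s\<in>{..<n}. bad s)"
    by (intro finite_measure_mono) auto
  also have "\<dots> \<le> (\<Sum>s<n. prob (bad s))"
    by (intro finite_measure_subadditive_finite) auto
  also have "\<dots> \<le> (\<Sum>s<n. phase_confidence \<rho> s)"
    unfolding bad_def by (intro sum_mono iterate_step(2) iterate_measurable)
  also have "\<dots> \<le> \<rho>" using \<rho> by (intro sum_phase_confidence_le) simp
  finally have "prob (space M - success) \<le> \<rho>" .
  moreover have "prob (space M - success) = 1 - prob success" by (rule prob_compl) measurable
  ultimately show ?thesis by (simp add: success_def)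
qed

end

end

section \<open>Complexity\<close>

lemma C_star_le_36: "C_star H1 \<le> 36"
proof -
  have "sqrt 2 \<le> 17 / 12" by (rule real_le_lsqrt) (auto simp: power2_eq_square)
  then show ?thesis by (simp add: C_star_def)
qed

lemma phase_length_le:
  assumes "2 \<le> ln (8 / \<rho>)" "0 \<le> D * clip_level p H0 H1 \<sigma>0 \<sigma>1 \<sigma>2 \<Delta> D / \<Delta>"
  shows "real (phase_length p H0 H1 \<sigma>0 \<sigma>1 \<sigma>2 \<Delta> D \<rho>)
    \<le> 1025 * (1 + D * clip_level p H0 H1 \<sigma>0 \<sigma>1 \<sigma>2 \<Delta> D / \<Delta>) * ln (8 / \<rho>)"
proof -
  define B where "B = (1 + D * clip_level p H0 H1 \<sigma>0 \<sigma>1 \<sigma>2 \<Delta> D / \<Delta>) * ln (8 / \<rho>)"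
  have "1 * 1 \<le> B" unfolding B_def using assms by (intro mult_mono) auto
  moreover have "real (nat \<lceil>1024 * B\<rceil>) \<le> 1024 * B + 1" using calculation by linarith
  ultimately have "real (nat \<lceil>1024 * B\<rceil>) \<le> 1025 * B" by linarith
  then show ?thesis by (simp only: phase_length_def B_def mult.assoc)
qed

lemma powr_sum3_le:
  fixes x y z c :: real
  assumes "0 \<le> x" "0 \<le> y" "0 \<le> z" "0 \<le> c" "0 \<le> r"
  shows "(c * (x + y + z)) powr r \<le> (3 * c * x) powr r + (3 * c * y) powr r + (3 * c * z) powr r"
proof -
  define w where "w = max x (max y z)"
  have w: "w \<in> {x, y, z}" "0 \<le> w" using assms by (auto simp: w_def max_def)
  have "c * (x + y + z) \<le> c * (3 * w)" using assms by (intro mult_left_mono) (auto simp: w_def)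
  then have "(c * (x + y + z)) powr r \<le> (3 * c * w) powr r"
    using assms by (intro powr_mono2) (auto simp: mult_ac)
  also have "\<dots> \<le> (3 * c * x) powr r + (3 * c * y) powr r + (3 * c * z) powr r"
    using w(1) by (auto simp: add_nonneg_nonneg)
  finally show ?thesis .
qed

lemma powr_sum2_le:
  fixes x y :: real
  assumes "0 \<le> x" "0 \<le> y" "0 \<le> r"
  shows "(x + y) powr r \<le> 2 powr r * (x powr r + y powr r)"
proof -
  define w where "w = max x y"
  have w: "w \<in> {x, y}" "0 \<le> w" using assms by (auto simp: w_def max_def)
  have "(x + y) powr r \<le> (2 * w) powr r" using assms by (intro powr_mono2) (auto simp: w_def)
  also have "\<dots> = 2 powr r * w powr r" using w by (simp add: powr_mult)
  also have "\<dots> \<le> 2 powr r * (x powr r + y powr r)" using w(1) by (intro mult_left_mono) auto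
  finally show ?thesis .
qed

text \<open>
  Here the conjugate exponent being at least \<open>2\<close> enters: the quantities below change by a factor \<open>sqrt 2\<close>
  from phase to phase, hence their \<open>q\<close>-th powers by a factor of at least \<open>2\<close>.
\<close>

lemma powr_sqrt_scale_le:
  assumes "0 \<le> c" "c \<le> 1" "2 \<le> q" "0 \<le> y"
  shows "(sqrt c * y) powr q \<le> c * y powr q"
proof -
  have "sqrt c powr q \<le> sqrt c powr 2"
  proof (cases "c = 0")
    case False
    then show ?thesis using assms by (intro powr_mono') (auto simp: real_sqrt_le_1_iff)
  qed simp
  also have "\<dots> = c" using assms by (simp add: powr_numeral)
  finally show ?thesis using assms by (simp add: powr_mult mult_right_mono)
qed

lemma conjugate_exponent:
  fixes p :: real
  assumes "1 < p" "p \<le> 2"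
  defines "q \<equiv> p / (p - 1)"
  shows "2 \<le> q" and "1 / (p - 1) = q - 1" and "p * (1 / (p - 1)) = q"
  using assms by (auto simp: field_simps)

text \<open>
  With \<open>d = D / \<Delta>\<close>, which is \<open>sqrt (8 / (\<mu> * \<Delta>))\<close>, the noise part of the clipping level contributes
  \<open>d * (64 * \<varsigma>\<^sup>p * d) powr (1 / (p - 1))\<close>. The exponents of \<open>d\<close> add up to \<open>q\<close>, and
  \<open>(x\<^sup>p) powr (1 / (p - 1)) = x\<^sup>q\<close>; this is where the conjugate exponent in the complexity bound comes
  from.
\<close>

lemma clip_ratio_le:
  assumes p: "1 < p" "p \<le> 2" and \<mu>: "0 < \<mu>" and \<Delta>: "0 < \<Delta>"
    and H: "0 \<le> H0" "0 \<le> H1" and \<sigma>: "0 \<le> \<sigma>0" "0 \<le> \<sigma>1" "0 \<le> \<sigma>2"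
  defines "q \<equiv> p / (p - 1)" and "D \<equiv> 2 * sqrt (2 * \<Delta> / \<mu>)"
  shows "0 \<le> D * clip_level p H0 H1 \<sigma>0 \<sigma>1 \<sigma>2 \<Delta> D / \<Delta>"
    and "D * clip_level p H0 H1 \<sigma>0 \<sigma>1 \<sigma>2 \<Delta> D / \<Delta> \<le> 192 * (sqrt (H0 / \<mu>) + sqrt (H1 * \<Delta> / \<mu>))
      + 192 powr (2 * q) * ((\<sigma>0 / sqrt (\<mu> * \<Delta>)) powr q
          + (\<sigma>1 / sqrt \<mu> * (sqrt H0 + sqrt (H1 * \<Delta>))) powr q + (\<sigma>2 / sqrt \<mu>) powr q)"
proof -
  define G where "G = grad_level H0 H1 \<Delta>"
  define d where "d = D / \<Delta>"
  define e where "e = 1 / (p - 1)"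
  note q = conjugate_exponent[OF p, folded q_def]
  have e: "0 \<le> e" "e = q - 1" "p * e = q" using p q by (auto simp: e_def)
  have D: "0 < D" using \<mu> \<Delta> by (simp add: D_def)
  have d: "0 < d" using D \<Delta> by (simp add: d_def)
  have G0: "0 \<le> G" by (simp add: G_def grad_level_def H \<Delta> less_imp_le C_star_ge_2[THEN order_trans[rotated]])
  have d2: "d\<^sup>2 = 8 / (\<mu> * \<Delta>)" using \<mu> \<Delta>
    by (simp add: d_def D_def power_divide power_mult_distrib) (simp add: power2_eq_square)
  have d_eq: "d = sqrt 8 / sqrt (\<mu> * \<Delta>)"
    using d d2 by (metis less_imp_le real_sqrt_divide real_sqrt_unique)
  have s8: "sqrt 8 \<le> 3" by (rule real_le_lsqrt) auto
  show "0 \<le> D * clip_level p H0 H1 \<sigma>0 \<sigma>1 \<sigma>2 \<Delta> D / \<Delta>"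
    using D \<Delta> G0 by (auto simp: clip_level_def G_def intro!: divide_nonneg_pos mult_nonneg_nonneg)
  have dG: "d * G \<le> 96 * (sqrt H0 + sqrt (H1 * \<Delta>)) / sqrt \<mu>"
  proof -
    have "(d * G)\<^sup>2 = 8 / (\<mu> * \<Delta>) * (32 * C_star H1 * \<Delta> * (H0 + H1 * \<Delta>))"
      unfolding power_mult_distrib d2 G_def grad_level_def
      using \<Delta> H C_star_ge_2[of H1] by simp
    also have "\<dots> = C_star H1 * (256 * (H0 + H1 * \<Delta>) / \<mu>)" using \<Delta> by simp
    also have "\<dots> \<le> 36 * (256 * (H0 + H1 * \<Delta>) / \<mu>)"
      using \<Delta> H \<mu> C_star_le_36 by (intro mult_right_mono) auto
    also have "\<dots> = 96\<^sup>2 * (H0 + H1 * \<Delta>) / \<mu>" by simp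
    also have "\<dots> \<le> 96\<^sup>2 * (sqrt H0 + sqrt (H1 * \<Delta>))\<^sup>2 / \<mu>"
      using \<Delta> H \<mu> by (intro divide_right_mono mult_left_mono) (auto simp: power2_sum)
    also have "\<dots> = (96 * (sqrt H0 + sqrt (H1 * \<Delta>)) / sqrt \<mu>)\<^sup>2"
      using \<mu> by (simp only: power_mult_distrib power_divide real_sqrt_pow2 less_imp_le)
    finally show ?thesis by (rule power2_le_imp_le) (use H \<Delta> \<mu> in auto)
  qed
  \<comment> \<open>\<open>x0\<close>, \<open>x1\<close>, \<open>x2\<close> are the levels of the three kinds of noise\<close>
  define x0 where "x0 = \<sigma>0"
  define x1 where "x1 = \<sigma>1 * G"
  define x2 where "x2 = \<sigma>2 * sqrt (4 * \<Delta>)"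
  have x: "0 \<le> x0" "0 \<le> x1" "0 \<le> x2" using \<sigma> G0 \<Delta> by (auto simp: x0_def x1_def x2_def)
  have m: "noise_level_pow p H0 H1 \<sigma>0 \<sigma>1 \<sigma>2 \<Delta> = x0 powr p + x1 powr p + x2 powr p"
    using \<sigma> G0 \<Delta> unfolding noise_level_pow_def x0_def x1_def x2_def G_def
    by (simp add: powr_mult powr_half_sqrt[symmetric] powr_powr)
  have term_eq: "d * (3 * (64 * d) * x powr p) powr e = 192 powr e * (d * x) powr q" if "0 \<le> x" for x
  proof -
    have "(3 * (64 * d) * x powr p) powr e = 192 powr e * d powr e * x powr (p * e)"
      using that d by (simp add: powr_mult powr_powr)
    also have "d * \<dots> = 192 powr e * (d powr (1 + e)) * x powr q"
      unfolding e(3) using d by (simp add: powr_add)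
    also have "1 + e = q" using e by simp
    finally show ?thesis using that d by (simp add: powr_mult)
  qed
  have term_le: "192 powr e * (d * x) powr q \<le> 192 powr (2 * q) * y powr q"
    if "0 \<le> x" "d * x \<le> 192 * y" for x y
  proof -
    have y: "0 \<le> y" using mult_nonneg_nonneg[OF less_imp_le[OF d] that(1)] that(2) by linarith
    have "192 powr e \<le> (192::real) powr q" by (rule powr_mono) (simp_all add: e(2))
    moreover have "(d * x) powr q \<le> (192 * y) powr q" using that(2) by (rule powr_mono2[rotated 2]) (use that(1) d q(1) in simp_all)
    ultimately have "192 powr e * (d * x) powr q \<le> 192 powr q * (192 * y) powr q"
      by (rule mult_mono) auto
    also have "\<dots> = 192 powr (2 * q) * y powr q"
    proof -
      have "192 powr (2 * q) = 192 powr q * (192::real) powr q"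
        by (simp only: mult_2 powr_add)
      then show ?thesis using y by (simp only: powr_mult[of 192 y] mult.assoc)
    qed
    finally show ?thesis .
  qed
  have "d * (64 * (x0 powr p + x1 powr p + x2 powr p) * d) powr e
      \<le> d * ((3 * (64 * d) * x0 powr p) powr e + (3 * (64 * d) * x1 powr p) powr e + (3 * (64 * d) * x2 powr p) powr e)"
    using powr_sum3_le[of "x0 powr p" "x1 powr p" "x2 powr p" "64 * d" e] d e
    by (intro mult_left_mono) (auto simp: mult_ac)
  also have "\<dots> = 192 powr e * (d * x0) powr q + 192 powr e * (d * x1) powr q + 192 powr e * (d * x2) powr q"
    by (simp only: distrib_left term_eq x)
  also have "\<dots> \<le> 192 powr (2 * q) * (\<sigma>0 / sqrt (\<mu> * \<Delta>)) powr q
      + 192 powr (2 * q) * (\<sigma>1 / sqrt \<mu> * (sqrt H0 + sqrt (H1 * \<Delta>))) powr q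
      + 192 powr (2 * q) * (\<sigma>2 / sqrt \<mu>) powr q"
  proof (intro add_mono term_le x)
    have "sqrt 8 * (\<sigma>0 / sqrt (\<mu> * \<Delta>)) \<le> 192 * (\<sigma>0 / sqrt (\<mu> * \<Delta>))"
      using s8 \<sigma> \<mu> \<Delta> by (intro mult_right_mono) auto
    then show "d * x0 \<le> 192 * (\<sigma>0 / sqrt (\<mu> * \<Delta>))" by (simp add: d_eq x0_def)
    have "\<sigma>1 * (d * G) \<le> \<sigma>1 * (96 * (sqrt H0 + sqrt (H1 * \<Delta>)) / sqrt \<mu>)"
      using dG \<sigma> by (intro mult_left_mono)
    also have "\<dots> = 96 * (\<sigma>1 / sqrt \<mu> * (sqrt H0 + sqrt (H1 * \<Delta>)))" by simp
    also have "\<dots> \<le> 192 * (\<sigma>1 / sqrt \<mu> * (sqrt H0 + sqrt (H1 * \<Delta>)))"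
      using \<sigma> H \<mu> \<Delta> by (intro mult_right_mono) auto
    finally show "d * x1 \<le> 192 * (\<sigma>1 / sqrt \<mu> * (sqrt H0 + sqrt (H1 * \<Delta>)))"
      by (simp add: x1_def mult_ac)
    have "d * x2 = sqrt 8 * 2 * (\<sigma>2 / sqrt \<mu>)"
      using \<mu> \<Delta> by (simp add: d_eq x2_def real_sqrt_mult)
    also have "\<dots> \<le> 192 * (\<sigma>2 / sqrt \<mu>)"
      using s8 \<sigma> \<mu> by (intro mult_right_mono) auto
    finally show "d * x2 \<le> 192 * (\<sigma>2 / sqrt \<mu>)" .
  qed
  finally have noise: "d * (64 * noise_level_pow p H0 H1 \<sigma>0 \<sigma>1 \<sigma>2 \<Delta> * d) powr e \<le> 192 powr (2 * q) * ((\<sigma>0 / sqrt (\<mu> * \<Delta>)) powr q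
          + (\<sigma>1 / sqrt \<mu> * (sqrt H0 + sqrt (H1 * \<Delta>))) powr q + (\<sigma>2 / sqrt \<mu>) powr q)"
    by (simp only: m distrib_left)
  have "D * clip_level p H0 H1 \<sigma>0 \<sigma>1 \<sigma>2 \<Delta> D / \<Delta> = d * clip_level p H0 H1 \<sigma>0 \<sigma>1 \<sigma>2 \<Delta> D"
    by (simp add: d_def)
  also have "\<dots> \<le> d * (2 * G + (64 * noise_level_pow p H0 H1 \<sigma>0 \<sigma>1 \<sigma>2 \<Delta> * d) powr e)"
    using d G0 by (intro mult_left_mono) (auto simp: clip_level_def G_def d_def e_def)
  also have "\<dots> = 2 * (d * G) + d * (64 * noise_level_pow p H0 H1 \<sigma>0 \<sigma>1 \<sigma>2 \<Delta> * d) powr e"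
    by (simp add: distrib_left)
  also have "2 * (d * G) \<le> 192 * (sqrt (H0 / \<mu>) + sqrt (H1 * \<Delta> / \<mu>))"
    using dG by (simp add: real_sqrt_divide add_divide_distrib distrib_left)
  also note noise
  finally show "D * clip_level p H0 H1 \<sigma>0 \<sigma>1 \<sigma>2 \<Delta> D / \<Delta> \<le> 192 * (sqrt (H0 / \<mu>) + sqrt (H1 * \<Delta> / \<mu>))
      + 192 powr (2 * q) * ((\<sigma>0 / sqrt (\<mu> * \<Delta>)) powr q
          + (\<sigma>1 / sqrt \<mu> * (sqrt H0 + sqrt (H1 * \<Delta>))) powr q + (\<sigma>2 / sqrt \<mu>) powr q)"
    by simp
qed

lemma geometric_sum_le:
  fixes x :: real
  assumes "0 \<le> x" "x < 1"
  shows "(\<Sum>s<n. x ^ s) \<le> 1 / (1 - x)"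
proof -
  have "(1 - x) * (\<Sum>s<n. x ^ s) = 1 - x ^ n" by (rule one_diff_power_eq[symmetric])
  also have "\<dots> \<le> 1" using assms by simp
  finally show ?thesis using assms by (simp add: field_simps)
qed

text \<open>
  The constant \<open>pi\<^sup>2 / 6\<close> is absorbed by a second copy of \<open>8 / \<rho>\<close>.
\<close>

lemma ln_phase_confidence_le:
  assumes "0 < \<rho>" "\<rho> < 1" "s < S"
  shows "ln (8 / phase_confidence \<rho> s) \<le> 2 * (ln (8 / \<rho>) + ln (real S + 1))"
proof -
  have "pi * pi \<le> 4 * 4" using pi_less_4 by (intro mult_mono) auto
  then have "pi\<^sup>2 / 6 \<le> 8" by (simp add: power2_eq_square)
  also have "8 \<le> 8 / \<rho>" using assms by (simp add: field_simps)
  finally have "8 / \<rho> * (pi\<^sup>2 / 6) * (real s + 1)\<^sup>2 \<le> 8 / \<rho> * (8 / \<rho>) * (real S + 1)\<^sup>2"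
    using assms by (intro mult_mono power_mono) auto
  then have "8 / phase_confidence \<rho> s \<le> (8 / \<rho>) * (8 / \<rho>) * (real S + 1)\<^sup>2"
    by (simp add: phase_confidence_def mult_ac)
  then have "ln (8 / phase_confidence \<rho> s) \<le> ln ((8 / \<rho>) * (8 / \<rho>) * (real S + 1)\<^sup>2)"
    using phase_confidence_bounds[OF assms(1,2), of s] by (intro ln_mono) auto
  also have "\<dots> = 2 * (ln (8 / \<rho>) + ln (real S + 1))"
  proof -
    have "ln (c * c * (real S + 1)\<^sup>2) = 2 * (ln c + ln (real S + 1))" if "0 < c" for c :: real
      using that by (simp add: ln_mult ln_realpow)
    from this[of "8 / \<rho>"] show ?thesis using assms by simp
  qed
  finally show ?thesis .
qed

lemma sqrt_phase_target:
  "0 \<le> c \<Longrightarrow> sqrt (c * phase_target \<Delta>0 s) = sqrt (c * \<Delta>0) * (1 / sqrt 2) ^ s"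
  by (simp add: phase_target_def real_sqrt_divide real_sqrt_mult real_sqrt_power power_divide)

text \<open>
  The bound \<open>clip_ratio_le\<close> with its dependence on the phase made explicit. The factors \<open>3 / 4\<close> and
  \<open>1 / 2\<close> bound powers of \<open>1 / sqrt 2\<close>. The noise \<open>\<sigma>0\<close> weighs most in the last phase, so its factor is
  counted from the end.
\<close>

lemma phase_ratio_le:
  assumes p: "1 < p" "p \<le> 2" and \<mu>: "0 < \<mu>" and \<epsilon>: "0 < \<epsilon>" "\<epsilon> \<le> \<Delta>0"
    and H: "0 \<le> H0" "0 \<le> H1" and \<sigma>: "0 \<le> \<sigma>0" "0 \<le> \<sigma>1" "0 \<le> \<sigma>2"
    and s: "s < num_phases \<Delta>0 \<epsilon>"
  defines "q \<equiv> p / (p - 1)" and "D \<equiv> 2 * ball_radius \<mu> \<Delta>0 s" and "\<Delta> \<equiv> phase_target \<Delta>0 s"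
  shows "D * clip_level p H0 H1 \<sigma>0 \<sigma>1 \<sigma>2 \<Delta> D / \<Delta>
      \<le> 192 * (sqrt (H0 / \<mu>) + sqrt (H1 * \<Delta>0 / \<mu>) * (3 / 4) ^ s)
        + 192 powr (2 * q) * ((1 / 2) ^ (num_phases \<Delta>0 \<epsilon> - Suc s) * (\<sigma>0 / sqrt (\<mu> * \<epsilon>)) powr q
            + 2 powr q * ((\<sigma>1 / sqrt \<mu> * sqrt H0) powr q + (1 / 2) ^ s * (\<sigma>1 / sqrt \<mu> * sqrt (H1 * \<Delta>0)) powr q)
            + (\<sigma>2 / sqrt \<mu>) powr q)"
proof -
  note q = conjugate_exponent(1)[OF p, folded q_def]
  have \<Delta>0: "0 < \<Delta>0" using \<epsilon> by simp
  have \<Delta>: "0 < \<Delta>" using \<Delta>0 by (simp add: \<Delta>_def phase_target_def)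
  have D: "D = 2 * sqrt (2 * \<Delta> / \<mu>)" by (simp add: D_def ball_radius_def \<Delta>_def)
  have "D * clip_level p H0 H1 \<sigma>0 \<sigma>1 \<sigma>2 \<Delta> D / \<Delta>
      \<le> 192 * (sqrt (H0 / \<mu>) + sqrt (H1 * \<Delta> / \<mu>))
      + 192 powr (2 * q) * ((\<sigma>0 / sqrt (\<mu> * \<Delta>)) powr q
          + (\<sigma>1 / sqrt \<mu> * (sqrt H0 + sqrt (H1 * \<Delta>))) powr q + (\<sigma>2 / sqrt \<mu>) powr q)"
    unfolding D q_def by (rule clip_ratio_le(2)[OF p \<mu> \<Delta> H \<sigma>])
  also have "\<dots> \<le> 192 * (sqrt (H0 / \<mu>) + sqrt (H1 * \<Delta>0 / \<mu>) * (3 / 4) ^ s)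
        + 192 powr (2 * q) * ((1 / 2) ^ (num_phases \<Delta>0 \<epsilon> - Suc s) * (\<sigma>0 / sqrt (\<mu> * \<epsilon>)) powr q
            + 2 powr q * ((\<sigma>1 / sqrt \<mu> * sqrt H0) powr q + (1 / 2) ^ s * (\<sigma>1 / sqrt \<mu> * sqrt (H1 * \<Delta>0)) powr q)
            + (\<sigma>2 / sqrt \<mu>) powr q)"
  proof (intro add_mono mult_left_mono order_refl)
    have "1 / sqrt 2 \<le> 3 / 4"
    proof -
      have "4 / 3 \<le> sqrt 2" by (rule real_le_rsqrt) (simp add: power2_eq_square)
      then show ?thesis by (simp add: field_simps)
    qed
    then have "(1 / sqrt 2) ^ s \<le> (3 / 4) ^ s" by (intro power_mono) auto
    moreover have "sqrt (H1 * \<Delta> / \<mu>) = sqrt (H1 * \<Delta>0 / \<mu>) * (1 / sqrt 2) ^ s"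
      using sqrt_phase_target[of "H1 / \<mu>" \<Delta>0 s] H \<mu> by (simp add: \<Delta>_def)
    ultimately show "sqrt (H1 * \<Delta> / \<mu>) \<le> sqrt (H1 * \<Delta>0 / \<mu>) * (3 / 4) ^ s"
      using H \<mu> \<Delta>0 by (simp add: mult_left_mono)
  next
    define c where "c = (1 / 2 :: real) ^ (num_phases \<Delta>0 \<epsilon> - Suc s)"
    have c: "0 < c" "c \<le> 1" by (auto simp: c_def power_le_one)
    have "\<epsilon> / c \<le> \<Delta>"
      using phase_target_ge[OF \<epsilon> s] by (simp add: c_def \<Delta>_def power_divide mult.commute)
    then have "\<mu> * \<epsilon> / c \<le> \<mu> * \<Delta>" using mult_left_mono[of "\<epsilon> / c" \<Delta> \<mu>] \<mu> by simp
    then have "sqrt (\<mu> * \<epsilon> / c) \<le> sqrt (\<mu> * \<Delta>)" by (rule real_sqrt_le_mono)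
    then have "\<sigma>0 / sqrt (\<mu> * \<Delta>) \<le> \<sigma>0 / sqrt (\<mu> * \<epsilon> / c)"
      using \<sigma> \<mu> \<epsilon> c \<Delta> by (intro divide_left_mono) auto
    also have "\<dots> = sqrt c * (\<sigma>0 / sqrt (\<mu> * \<epsilon>))" by (simp add: real_sqrt_divide)
    finally have "(\<sigma>0 / sqrt (\<mu> * \<Delta>)) powr q \<le> (sqrt c * (\<sigma>0 / sqrt (\<mu> * \<epsilon>))) powr q"
      using \<sigma> q \<mu> \<Delta> by (intro powr_mono2) auto
    also have "\<dots> \<le> c * (\<sigma>0 / sqrt (\<mu> * \<epsilon>)) powr q"
      using c q \<sigma> \<mu> \<epsilon> by (intro powr_sqrt_scale_le) auto
    finally show "(\<sigma>0 / sqrt (\<mu> * \<Delta>)) powr q \<le> (1 / 2) ^ (num_phases \<Delta>0 \<epsilon> - Suc s) * (\<sigma>0 / sqrt (\<mu> * \<epsilon>)) powr q"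
      by (simp add: c_def)
  next
    define c where "c = (1 / 2 :: real) ^ s"
    have c: "0 \<le> c" "c \<le> 1" by (auto simp: c_def power_le_one)
    have "sqrt (H1 * \<Delta>) = sqrt c * sqrt (H1 * \<Delta>0)"
      by (simp add: \<Delta>_def c_def phase_target_def power_divide flip: real_sqrt_mult)
    then have "\<sigma>1 / sqrt \<mu> * (sqrt H0 + sqrt (H1 * \<Delta>)) = \<sigma>1 / sqrt \<mu> * sqrt H0 + sqrt c * (\<sigma>1 / sqrt \<mu> * sqrt (H1 * \<Delta>0))"
      by (simp add: distrib_left)
    then have "(\<sigma>1 / sqrt \<mu> * (sqrt H0 + sqrt (H1 * \<Delta>))) powr q
        \<le> 2 powr q * ((\<sigma>1 / sqrt \<mu> * sqrt H0) powr q + (sqrt c * (\<sigma>1 / sqrt \<mu> * sqrt (H1 * \<Delta>0))) powr q)"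
      using powr_sum2_le[of "\<sigma>1 / sqrt \<mu> * sqrt H0" "sqrt c * (\<sigma>1 / sqrt \<mu> * sqrt (H1 * \<Delta>0))" q] \<sigma> \<mu> H \<Delta>0 c q by simp
    also have "\<dots> \<le> 2 powr q * ((\<sigma>1 / sqrt \<mu> * sqrt H0) powr q + c * (\<sigma>1 / sqrt \<mu> * sqrt (H1 * \<Delta>0)) powr q)"
      using \<sigma> \<mu> H \<Delta>0 c q by (intro mult_left_mono add_left_mono powr_sqrt_scale_le) auto
    finally show "(\<sigma>1 / sqrt \<mu> * (sqrt H0 + sqrt (H1 * \<Delta>))) powr q
        \<le> 2 powr q * ((\<sigma>1 / sqrt \<mu> * sqrt H0) powr q + (1 / 2) ^ s * (\<sigma>1 / sqrt \<mu> * sqrt (H1 * \<Delta>0)) powr q)"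
      by (simp add: c_def)
  qed auto
  finally show ?thesis .
qed

text \<open>
  The factor \<open>2050\<close> is \<open>1025\<close> from rounding up the phase length times \<open>2\<close> from the logarithm; the factor
  \<open>768 = 4 * 192\<close> comes from the largest geometric sum; the powers come from the noise terms.
\<close>

definition complexity_constant :: "real \<Rightarrow> real" where
  "complexity_constant q = 2050 * (768 * (2 powr q * 192 powr (2 * q)))"

lemma rcsag_calls_le:
  assumes p: "1 < p" "p \<le> 2" and \<mu>: "0 < \<mu>" and \<epsilon>: "0 < \<epsilon>" "\<epsilon> \<le> \<Delta>0"
    and H: "0 \<le> H0" "0 \<le> H1" and \<sigma>: "0 \<le> \<sigma>0" "0 \<le> \<sigma>1" "0 \<le> \<sigma>2" and \<rho>: "0 < \<rho>" "\<rho> < 1"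
  defines "q \<equiv> p / (p - 1)" and "S \<equiv> real (num_phases \<Delta>0 \<epsilon>)"
  shows "real (rcsag_calls p H0 H1 \<sigma>0 \<sigma>1 \<sigma>2 \<mu> \<Delta>0 \<rho> \<epsilon>)
    \<le> complexity_constant q * (ln (8 / \<rho>) + ln (S + 1)) *
        ((1 + sqrt (H0 / \<mu>)) * S
         + sqrt (H1 * \<Delta>0 / \<mu>)
         + (\<sigma>0 / sqrt (\<mu> * \<epsilon>)) powr q
         + (\<sigma>1 / sqrt \<mu> * (sqrt H0 * S powr (1 / q) + sqrt (H1 * \<Delta>0))) powr q
         + (\<sigma>2 / sqrt \<mu>) powr q * S)"
proof -
  note q = conjugate_exponent(1)[OF p, folded q_def]
  define n where "n = num_phases \<Delta>0 \<epsilon>"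
  have S: "S = real n" "0 \<le> S" by (simp_all add: S_def n_def)
  have \<Delta>0: "0 < \<Delta>0" using \<epsilon> by simp
  define L where "L = ln (8 / \<rho>) + ln (S + 1)"
  define h0 where "h0 = sqrt (H0 / \<mu>)"
  define h1 where "h1 = sqrt (H1 * \<Delta>0 / \<mu>)"
  define P where "P = (\<sigma>0 / sqrt (\<mu> * \<epsilon>)) powr q"
  define b0 where "b0 = (\<sigma>1 / sqrt \<mu> * sqrt H0) powr q"
  define b1 where "b1 = (\<sigma>1 / sqrt \<mu> * sqrt (H1 * \<Delta>0)) powr q"
  define X where "X = (\<sigma>1 / sqrt \<mu> * (sqrt H0 * S powr (1 / q) + sqrt (H1 * \<Delta>0))) powr q"
  define Z where "Z = (\<sigma>2 / sqrt \<mu>) powr q"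
  define K1 where "K1 = 192 powr (2 * q)"
  define K2 where "K2 = 2 powr q"
  define R where "R s = 192 * (h0 + h1 * (3 / 4) ^ s)
      + K1 * ((1 / 2) ^ (n - Suc s) * P + K2 * (b0 + (1 / 2) ^ s * b1) + Z)" for s
  have nn: "0 \<le> h0" "0 \<le> h1" "0 \<le> P" "0 \<le> b0" "0 \<le> b1" "0 \<le> X" "0 \<le> Z"
    using H \<mu> \<Delta>0 by (simp_all add: h0_def h1_def P_def b0_def b1_def X_def Z_def)
  have K: "1 \<le> K1" "1 \<le> K2" using q by (auto simp: K1_def K2_def intro: ge_one_powr_ge_zero)
  have L: "0 \<le> L"
  proof -
    have "0 \<le> ln (8 / \<rho>)" "0 \<le> ln (S + 1)" using \<rho> S by (auto intro!: ln_ge_zero simp: field_simps)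
    then show ?thesis by (simp add: L_def)
  qed
  have phase: "real (phase_length p H0 H1 \<sigma>0 \<sigma>1 \<sigma>2 (phase_target \<Delta>0 s) (2 * ball_radius \<mu> \<Delta>0 s) (phase_confidence \<rho> s))
      \<le> 2050 * L * (1 + R s)" if s: "s < n" for s
  proof -
    define D where "D = 2 * ball_radius \<mu> \<Delta>0 s"
    define \<Delta> where "\<Delta> = phase_target \<Delta>0 s"
    define r where "r = D * clip_level p H0 H1 \<sigma>0 \<sigma>1 \<sigma>2 \<Delta> D / \<Delta>"
    have \<Delta>: "0 < \<Delta>" using \<Delta>0 by (simp add: \<Delta>_def phase_target_def)
    have "D = 2 * sqrt (2 * \<Delta> / \<mu>)" by (simp add: D_def ball_radius_def \<Delta>_def)
    then have r0: "0 \<le> r" unfolding r_def using clip_ratio_le(1)[OF p \<mu> \<Delta> H \<sigma>] by simp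
    have rR: "r \<le> R s"
      using phase_ratio_le[OF p \<mu> \<epsilon> H \<sigma>] s
      by (simp add: r_def R_def D_def \<Delta>_def n_def q_def h0_def h1_def P_def b0_def b1_def Z_def K1_def K2_def)
    have conf: "0 < phase_confidence \<rho> s" "phase_confidence \<rho> s < 1"
      using phase_confidence_bounds[OF \<rho>] by auto
    have "ln 8 \<le> ln (8 / phase_confidence \<rho> s)"
      using conf by (intro ln_mono) (auto simp: field_simps)
    then have l2: "2 \<le> ln (8 / phase_confidence \<rho> s)" using ln_8_ge_2 by simp
    have "real (phase_length p H0 H1 \<sigma>0 \<sigma>1 \<sigma>2 \<Delta> D (phase_confidence \<rho> s))
        \<le> 1025 * (1 + r) * ln (8 / phase_confidence \<rho> s)"
      using phase_length_le[OF l2] r0 by (simp add: r_def)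
    also have "\<dots> \<le> 1025 * (1 + R s) * (2 * L)"
      using rR r0 l2 ln_phase_confidence_le[OF \<rho> s] by (intro mult_mono) (auto simp: L_def S)
    finally show ?thesis by (simp add: D_def \<Delta>_def mult_ac)
  qed
  have sum_R: "(\<Sum>s<n. R s) \<le> 192 * (S * h0 + 4 * h1) + K1 * (2 * P + K2 * (S * b0 + 2 * b1) + S * Z)"
  proof -
    have g1: "(\<Sum>s<n. (3 / 4 :: real) ^ s) \<le> 4"
      using geometric_sum_le[of "3 / 4" n] by simp
    have g2: "(\<Sum>s<n. (1 / 2 :: real) ^ s) \<le> 2"
      using geometric_sum_le[of "1 / 2" n] by simp
    have g3: "(\<Sum>s<n. (1 / 2 :: real) ^ (n - Suc s)) \<le> 2"
      using g2 by (simp only: sum.nat_diff_reindex)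
    have "(\<Sum>s<n. R s) = 192 * (S * h0 + h1 * (\<Sum>s<n. (3 / 4) ^ s))
        + K1 * ((\<Sum>s<n. (1 / 2) ^ (n - Suc s)) * P + K2 * (S * b0 + (\<Sum>s<n. (1 / 2) ^ s) * b1) + S * Z)"
      unfolding R_def
      by (simp add: sum.distrib S flip: sum_distrib_left sum_distrib_right)
    also have "\<dots> \<le> 192 * (S * h0 + h1 * 4) + K1 * (2 * P + K2 * (S * b0 + 2 * b1) + S * Z)"
      using nn K g1 g2 g3
      by (intro add_mono mult_left_mono mult_right_mono order_refl) auto
    finally show ?thesis by (simp add: mult.commute)
  qed
  have "S * b0 \<le> X"
  proof -
    have "S * b0 = (\<sigma>1 / sqrt \<mu> * (sqrt H0 * S powr (1 / q))) powr q"
      using q S \<sigma> \<mu> H by (simp add: b0_def powr_mult powr_powr powr_divide)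
    also have "\<dots> \<le> X"
      unfolding X_def using q \<sigma> \<mu> H \<Delta>0 by (intro powr_mono2 mult_left_mono) auto
    finally show ?thesis .
  qed
  moreover have "b1 \<le> X"
    unfolding b1_def X_def using q \<sigma> \<mu> H \<Delta>0 by (intro powr_mono2 mult_left_mono) auto
  ultimately have "K1 * (K2 * (S * b0 + 2 * b1)) \<le> K1 * (K2 * (3 * X))"
    using K by (intro mult_left_mono) auto
  then have bX: "K1 * (K2 * (S * b0 + 2 * b1)) \<le> 3 * (K2 * K1) * X" by (simp add: mult_ac)
  define C where "C = 768 * (K2 * K1)"
  have KK: "K1 \<le> K2 * K1" "1 \<le> K2 * K1"
    using K mult_right_mono[of 1 K2 K1] mult_mono[of 1 K2 1 K1] by auto
  have "(\<Sum>s<n. 1 + R s) = S + (\<Sum>s<n. R s)" by (simp add: sum.distrib S)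
  also have "\<dots> \<le> 1 * S + 192 * (S * h0) + 768 * h1 + 2 * K1 * P + 3 * (K2 * K1) * X + K1 * (S * Z)"
    using sum_R bX by (simp add: algebra_simps)
  also have "\<dots> \<le> C * S + C * (S * h0) + C * h1 + C * P + C * X + C * (S * Z)"
  proof -
    have "1 \<le> C" "192 \<le> C" "768 \<le> C" "2 * K1 \<le> C" "3 * (K2 * K1) \<le> C" "K1 \<le> C"
      unfolding C_def using KK K by linarith+
    then show ?thesis by (intro add_mono mult_right_mono mult_nonneg_nonneg nn S(2))
  qed
  also have "\<dots> = C * ((1 + h0) * S + h1 + P + X + Z * S)"
    by (simp add: algebra_simps)
  finally have total: "(\<Sum>s<n. 1 + R s) \<le> C * ((1 + h0) * S + h1 + P + X + Z * S)" .
  have "real (rcsag_calls p H0 H1 \<sigma>0 \<sigma>1 \<sigma>2 \<mu> \<Delta>0 \<rho> \<epsilon>) \<le> (\<Sum>s<n. 2050 * L * (1 + R s))"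
    unfolding rcsag_calls_def calls_before_def of_nat_sum n_def[symmetric]
    by (intro sum_mono phase) auto
  also have "\<dots> = 2050 * L * (\<Sum>s<n. 1 + R s)" by (simp only: sum_distrib_left)
  also have "\<dots> \<le> 2050 * L * (C * ((1 + h0) * S + h1 + P + X + Z * S))"
    using total L by (intro mult_left_mono) auto
  also have "\<dots> = complexity_constant q * L * ((1 + h0) * S + h1 + P + X + Z * S)"
    by (simp add: complexity_constant_def C_def K1_def K2_def)
  finally show ?thesis
    by (simp only: L_def h0_def h1_def P_def X_def Z_def)
qed

section \<open>Convergence of the restarted method\<close>

theorem theorem10:
  fixes p :: real
  assumes "1 < p" and "p \<le> 2"
  shows "\<exists>C>0. \<forall>H0 H1 \<sigma>0 \<sigma>1 \<sigma>2 \<mu> \<Delta>0 \<epsilon> \<rho> :: real.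
    0 \<le> H0 \<longrightarrow> 0 \<le> H1 \<longrightarrow> 0 \<le> \<sigma>0 \<longrightarrow> 0 \<le> \<sigma>1 \<longrightarrow> 0 \<le> \<sigma>2 \<longrightarrow>
    0 < \<mu> \<longrightarrow> 0 < \<epsilon> \<longrightarrow> \<epsilon> \<le> \<Delta>0 \<longrightarrow> 0 < \<rho> \<longrightarrow> \<rho> < 1 \<longrightarrow>
    (\<forall>(f :: 'a::euclidean_space \<Rightarrow> real) x0 (M :: 'w measure) (\<Xi> :: 'b measure) \<xi> g.
       has_minimizer f \<longrightarrow>
       strongly_convex \<mu> f \<longrightarrow>
       H0_H1_smooth H0 H1 f \<longrightarrow>
       stochastic_oracle p \<sigma>0 \<sigma>1 \<sigma>2 f M \<Xi> \<xi> g \<longrightarrow>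
       excess f x0 \<le> \<Delta>0 \<longrightarrow>
       measure M {\<omega> \<in> space M.
         excess f (rcsag_output p H0 H1 \<sigma>0 \<sigma>1 \<sigma>2 \<mu> \<Delta>0 \<rho> \<epsilon> (\<lambda>n u. g u (\<xi> n \<omega>)) x0) \<le> \<epsilon>}
       \<ge> 1 - \<rho>) \<and>
    (let q = p / (p - 1); S = real (num_phases \<Delta>0 \<epsilon>)
     in real (rcsag_calls p H0 H1 \<sigma>0 \<sigma>1 \<sigma>2 \<mu> \<Delta>0 \<rho> \<epsilon>)
        \<le> C * (ln (8 / \<rho>) + ln (S + 1)) *
            ((1 + sqrt (H0 / \<mu>)) * S
             + sqrt (H1 * \<Delta>0 / \<mu>)
             + (\<sigma>0 / sqrt (\<mu> * \<epsilon>)) powr q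
             + (\<sigma>1 / sqrt \<mu> * (sqrt H0 * S powr (1 / q) + sqrt (H1 * \<Delta>0))) powr q
             + (\<sigma>2 / sqrt \<mu>) powr q * S))"
proof (intro exI[of _ "complexity_constant (p / (p - 1))"] conjI allI impI)
  show "0 < complexity_constant (p / (p - 1))" by (simp add: complexity_constant_def)
next
  fix H0 H1 \<sigma>0 \<sigma>1 \<sigma>2 \<mu> \<Delta>0 \<epsilon> \<rho> :: real
    and f :: "'a \<Rightarrow> real" and x0 and M :: "'w measure" and \<Xi> :: "'b measure" and \<xi> g
  assume \<mu>: "0 < \<mu>" and \<epsilon>: "0 < \<epsilon>" "\<epsilon> \<le> \<Delta>0" and \<rho>: "0 < \<rho>" "\<rho> < 1"
    and f: "has_minimizer f" "strongly_convex \<mu> f" "H0_H1_smooth H0 H1 f"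
    and samples: "stochastic_oracle p \<sigma>0 \<sigma>1 \<sigma>2 f M \<Xi> \<xi> g" and start: "excess f x0 \<le> \<Delta>0"
  obtain xs where xs: "\<And>x. f xs \<le> f x" using f by (auto simp: has_minimizer_def)
  interpret oracle_objective f \<mu> H0 H1 xs p \<sigma>0 \<sigma>1 \<sigma>2 M \<Xi> \<xi> g
    by unfold_locales (use f \<mu> samples xs in auto)
  define n where "n = num_phases \<Delta>0 \<epsilon>"
  have \<Delta>0: "0 < \<Delta>0" using \<epsilon> by simp
  have [measurable]: "iterate \<Delta>0 \<rho> x0 n \<in> borel_measurable M"
    by (rule measurable_Fil_imp[OF iterate_measurable[OF \<Delta>0 \<rho>]])
  have "1 - \<rho> \<le> prob {\<omega> \<in> space M. F (iterate \<Delta>0 \<rho> x0 n \<omega>) \<le> phase_target \<Delta>0 n}"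
    by (rule success_probability[OF \<Delta>0 \<rho> start])
  also have "\<dots> \<le> prob {\<omega> \<in> space M. F (iterate \<Delta>0 \<rho> x0 n \<omega>) \<le> \<epsilon>}"
  proof (rule finite_measure_mono)
    show "{\<omega> \<in> space M. F (iterate \<Delta>0 \<rho> x0 n \<omega>) \<le> phase_target \<Delta>0 n} \<subseteq> {\<omega> \<in> space M. F (iterate \<Delta>0 \<rho> x0 n \<omega>) \<le> \<epsilon>}"
      using phase_target_le[OF \<epsilon>] by (auto simp: n_def)
  qed measurable
  finally show "1 - \<rho> \<le> prob {\<omega> \<in> space M.
      excess f (rcsag_output p H0 H1 \<sigma>0 \<sigma>1 \<sigma>2 \<mu> \<Delta>0 \<rho> \<epsilon> (\<lambda>n u. g u (\<xi> n \<omega>)) x0) \<le> \<epsilon>}"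
    by (simp add: iterate_def[OF \<Delta>0 \<rho>] rcsag_output_def n_def)
next
  fix H0 H1 \<sigma>0 \<sigma>1 \<sigma>2 \<mu> \<Delta>0 \<epsilon> \<rho> :: real
  assume "0 \<le> H0" "0 \<le> H1" "0 \<le> \<sigma>0" "0 \<le> \<sigma>1" "0 \<le> \<sigma>2" "0 < \<mu>" "0 < \<epsilon>" "\<epsilon> \<le> \<Delta>0" "0 < \<rho>" "\<rho> < 1"
  then show "let q = p / (p - 1); S = real (num_phases \<Delta>0 \<epsilon>)
     in real (rcsag_calls p H0 H1 \<sigma>0 \<sigma>1 \<sigma>2 \<mu> \<Delta>0 \<rho> \<epsilon>)
        \<le> complexity_constant (p / (p - 1)) * (ln (8 / \<rho>) + ln (S + 1)) *
            ((1 + sqrt (H0 / \<mu>)) * S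
             + sqrt (H1 * \<Delta>0 / \<mu>)
             + (\<sigma>0 / sqrt (\<mu> * \<epsilon>)) powr q
             + (\<sigma>1 / sqrt \<mu> * (sqrt H0 * S powr (1 / q) + sqrt (H1 * \<Delta>0))) powr q
             + (\<sigma>2 / sqrt \<mu>) powr q * S)"
    unfolding Let_def by (intro rcsag_calls_le assms)
qed

end
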